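(* Assume the Continuum Hypothesis. Then there exist sets of reals $A$ and $B$, each satisfying $\mathsf{S}_1(\mathcal{B}_\Omega,\mathcal{B}_\Gamma)$, such that $A\cup B$ does not satisfy $\binom{\Omega}{\mathrm{T}}$. In particular, $\mathsf{S}_1(\mathrm{T},\Gamma)\neq\mathsf{S}_1(\Omega,\Gamma)$ and $\mathsf{S}_1(\mathcal{B}_\mathrm{T},\mathcal{B}_\Gamma)\neq\mathsf{S}_1(\mathcal{B}_\Omega,\mathcal{B}_\Gamma)$ (as classes of sets of reals).
   Context: All spaces $X$ are infinite sets of reals, and all covers considered are assumed not to contain $X$ as a member. A cover is an $\omega$-cover of $X$ if every finite subset of $X$ is contained in some member; a $\gamma$-cover if it is infinite and each point of $X$ lies in all but finitely many members; large if each point lies in infinitely many members. A large cover $\mathcal{U}$ of $X$ is a $\tau$-cover if for all $x,y\in X$, either ($x\in U\Rightarrow y\in U$) for all but finitely many $U\in\mathcal{U}$, or ($y\in U\Rightarrow x\in U$) for all but finitely many $U\in\mathcal{U}$. $\Omega,\Gamma,\mathrm{T}$ denote the collections of countable open $\omega$-, $\gamma$-, $\tau$-covers of $X$, and $\mathcal{B}_\Omega,\mathcal{B}_\Gamma,\mathcal{B}_\mathrm{T}$ the collections of countable Borel $\omega$-, $\gamma$-, $\tau$-covers. For collections $\mathfrak{U},\mathfrak{V}$ of covers: $X$ satisfies $\mathsf{S}_1(\mathfrak{U},\mathfrak{V})$ if for every sequence $(\mathcal{U}_n)_{n\in\mathbb{N}}$ of members of $\mathfrak{U}$ there are $V_n\in\mathcal{U}_n$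 with $\{V_n:n\in\mathbb{N}\}\in\mathfrak{V}$; $X$ satisfies $\binom{\mathfrak{U}}{\mathfrak{V}}$ if every $\mathcal{U}\in\mathfrak{U}$ has a subcollection $\mathcal{V}\subseteq\mathcal{U}$ with $\mathcal{V}\in\mathfrak{V}$. Properties are identified with the classes of sets of reals satisfying them. *)

theory Defs
  imports "HOL-Analysis.Analysis"
begin

definition continuum_hypothesis :: bool where
  "continuum_hypothesis \<longleftrightarrow>
     (\<forall>S :: real set. countable S \<or> S \<approx> (UNIV :: real set))"

text \<open>Covers of a space \<open>X\<close> consist of subsets of \<open>X\<close> (openness and Borelness being relative to
  \<open>X\<close>), and never contain \<open>X\<close> itself.\<close>

definition is_cover :: "'a set \<Rightarrow> 'a set set \<Rightarrow> bool" where
  "is_cover X \<U> \<longleftrightarrow> \<Union>\<U> = X \<and> X \<notin> \<U>"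

definition omega_cover :: "'a set \<Rightarrow> 'a set set \<Rightarrow> bool" where
  "omega_cover X \<U> \<longleftrightarrow>
     is_cover X \<U> \<and> (\<forall>F. finite F \<and> F \<subseteq> X \<longrightarrow> (\<exists>U\<in>\<U>. F \<subseteq> U))"

definition gamma_cover :: "'a set \<Rightarrow> 'a set set \<Rightarrow> bool" where
  "gamma_cover X \<U> \<longleftrightarrow>
     is_cover X \<U> \<and> infinite \<U> \<and> (\<forall>x\<in>X. finite {U\<in>\<U>. x \<notin> U})"

definition large_cover :: "'a set \<Rightarrow> 'a set set \<Rightarrow> bool" where
  "large_cover X \<U> \<longleftrightarrow> is_cover X \<U> \<and> (\<forall>x\<in>X. infinite {U\<in>\<U>. x \<in> U})"

definition tau_cover :: "'a set \<Rightarrow> 'a set set \<Rightarrow> bool" where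
  "tau_cover X \<U> \<longleftrightarrow>
     large_cover X \<U> \<and>
     (\<forall>x\<in>X. \<forall>y\<in>X. finite {U\<in>\<U>. \<not> (x \<in> U \<longrightarrow> y \<in> U)} \<or>
                  finite {U\<in>\<U>. \<not> (y \<in> U \<longrightarrow> x \<in> U)})"

text \<open>The operators below turn a kind of cover into the assignment sending a space \<open>X\<close> to the
  collection of its countable open (respectively Borel) covers of that kind.\<close>

definition open_covers :: "(real set \<Rightarrow> real set set \<Rightarrow> bool) \<Rightarrow> real set \<Rightarrow> real set set set" where
  "open_covers K X =
     {\<U>. countable \<U> \<and> (\<forall>U\<in>\<U>. openin (top_of_set X) U) \<and> K X \<U>}"

definition borel_covers :: "(real set \<Rightarrow> real set set \<Rightarrow> bool) \<Rightarrow> real set \<Rightarrow> real set set set" where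
  "borel_covers K X =
     {\<U>. countable \<U> \<and> (\<forall>U\<in>\<U>. U \<in> sets (restrict_space borel X)) \<and> K X \<U>}"

abbreviation Open_Omega :: "real set \<Rightarrow> real set set set" where
  "Open_Omega \<equiv> open_covers omega_cover"
abbreviation Open_Gamma :: "real set \<Rightarrow> real set set set" where
  "Open_Gamma \<equiv> open_covers gamma_cover"
abbreviation Open_Tau :: "real set \<Rightarrow> real set set set" where
  "Open_Tau \<equiv> open_covers tau_cover"
abbreviation Borel_Omega :: "real set \<Rightarrow> real set set set" where
  "Borel_Omega \<equiv> borel_covers omega_cover"
abbreviation Borel_Gamma :: "real set \<Rightarrow> real set set set" where
  "Borel_Gamma \<equiv> borel_covers gamma_cover"
abbreviation Borel_Tau :: "real set \<Rightarrow> real set set set" where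
  "Borel_Tau \<equiv> borel_covers tau_cover"

text \<open>Properties are identified with the classes of spaces, that is, of infinite sets of reals,
  satisfying them.\<close>

definition S1 ::
  "(real set \<Rightarrow> real set set set) \<Rightarrow> (real set \<Rightarrow> real set set set) \<Rightarrow> real set set" where
  "S1 \<UU> \<VV> =
     {X. infinite X \<and>
         (\<forall>\<U> :: nat \<Rightarrow> real set set. (\<forall>n. \<U> n \<in> \<UU> X) \<longrightarrow>
            (\<exists>V. (\<forall>n. V n \<in> \<U> n) \<and> range V \<in> \<VV> X))}"

definition subcover_prop ::
  "(real set \<Rightarrow> real set set set) \<Rightarrow> (real set \<Rightarrow> real set set set) \<Rightarrow> real set set" where
  "subcover_prop \<UU> \<VV> =
     {X. infinite X \<and> (\<forall>\<U>\<in>\<UU> X. \<exists>\<V>. \<V> \<subseteq> \<U> \<and> \<V> \<in> \<VV> X)}"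

end

theory Submission
  imports Defs
begin

text \<open>Under CH a transfinite fusion of length $\omega_1$ builds disjoint $A, B \subseteq [0,1]$. A
  condition consists of the countable parts of $A$ and $B$ chosen so far and of a countable family
  of uncountable compact sets from which all later points are taken. Given a sequence of countable
  Borel families, either some finite set of available points is captured by no member of one of the
  families, and adding it to $A$ (or $B$) destroys the $\omega$-cover; or the compact sets can be thinned
  out so that one member from each family eventually contains every point that is or may still be
  chosen. The thinning rests on the perfect set theorem, since if each $V$ in a countable family met one
  of finitely many uncountable sets in a countable set only, then picking from each of these sets a point
  outside the exceptional ones would give an uncaptured finite set. All the while, for each Borel set $C$
  some point is added that prevents $C$ from separating $A$ and $B$.

  The set $Y = A \cup (B + 2)$ then satisfies $S_1(B_T, B_\Gamma)$: a $\tau$-cover has a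
  subfamily that is $\gamma$ on $A$ and still large on $Y$, hence one that is $\gamma$ on both parts.
  If $Y$ also satisfied $(\Omega, T)$, it would satisfy $(\Omega, \Gamma)$; but a $\gamma$-subcover of the
  $\omega$-cover by the sets $(A \cap G) \cup ((B \setminus \overline{G}) + 2)$, with $G$ a finite union of
  rational intervals, yields a Borel set separating $A$ from $B$.\<close>

section \<open>Fusion of compact sets of reals\<close>

text \<open>At most countably many points of \<open>Y\<close> lie on the countable side of some
  rational cut. Any rational between two of the remaining points leaves uncountably many points on
  both sides.\<close>

lemma uncountable_split:
  fixes Y :: "real set"
  assumes "uncountable Y"
  obtains t where "t \<in> \<rat>" "uncountable (Y \<inter> {..<t})" "uncountable (Y \<inter> {t<..})"
proof -
  define L where "L = (\<Union>t\<in>{t\<in>\<rat>. countable (Y \<inter> {..<t})}. Y \<inter> {..<t})"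
  define R where "R = (\<Union>t\<in>{t\<in>\<rat>. countable (Y \<inter> {t<..})}. Y \<inter> {t<..})"
  have "countable (L \<union> R)"
    unfolding L_def R_def
    by (intro countable_Un countable_UN) (auto intro: countable_subset[OF _ countable_rat])
  then have "infinite (Y - (L \<union> R))"
    using assms countable_finite uncountable_minus_countable by blast
  then obtain x y where xy: "x \<in> Y - (L \<union> R)" "y \<in> Y - (L \<union> R)" "x < y"
    by (metis finite.emptyI finite_insert finite_subset insert_iff linorder_neqE_linordered_idom subsetI)
  obtain t where "t \<in> \<rat>" "x < t" "t < y"
    using Rats_dense_in_real[OF xy(3)] by auto
  with xy that show ?thesis
    unfolding L_def R_def by fastforce
qed

section \<open>Rational intervals as a countable base\<close>

definition rat_intervals :: "real set set" where
  "rat_intervals = {{a<..<b} |a b. a \<in> \<rat> \<and> b \<in> \<rat>}"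

lemma countable_rat_intervals: "countable rat_intervals"
proof -
  have "rat_intervals = (\<lambda>(a, b). {a<..<b}) ` (\<rat> \<times> \<rat>)"
    by (auto simp: rat_intervals_def)
  moreover have "countable (\<rat> \<times> \<rat> :: (real \<times> real) set)"
    by (intro countable_SIGMA countable_rat)
  ultimately show ?thesis
    by (metis countable_image)
qed

lemma open_rat_intervals: "U \<in> rat_intervals \<Longrightarrow> open U"
  by (auto simp: rat_intervals_def)

lemma rat_intervals_nbhd:
  fixes x :: real
  assumes "open V" "x \<in> V"
  obtains U where "U \<in> rat_intervals" "x \<in> U" "closure U \<subseteq> V"
proof -
  obtain e where e: "e > 0" "cball x e \<subseteq> V"
    using assms open_contains_cball by blast
  obtain a where a: "a \<in> \<rat>" "x - e < a" "a < x"
    using Rats_dense_in_real[of "x - e" x] e by auto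
  obtain b where b: "b \<in> \<rat>" "x < b" "b < x + e"
    using Rats_dense_in_real[of x "x + e"] e by auto
  have "{a..b} \<subseteq> cball x e"
    using a b by (auto simp: dist_real_def)
  with a b e that[of "{a<..<b}"] show ?thesis
    by (auto simp: rat_intervals_def)
qed

lemma uncountable_rat_intervals:
  fixes Y V :: "real set"
  assumes "uncountable (Y \<inter> V)" "open V"
  obtains U where "U \<in> rat_intervals" "closure U \<subseteq> V" "uncountable (Y \<inter> U)"
proof -
  have "Y \<inter> V \<subseteq> (\<Union>U\<in>{U \<in> rat_intervals. closure U \<subseteq> V}. Y \<inter> U)"
    using rat_intervals_nbhd[OF assms(2)] by blast
  moreover have "countable {U \<in> rat_intervals. closure U \<subseteq> V}"
    by (rule countable_subset[OF _ countable_rat_intervals]) auto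
  ultimately show ?thesis
    using assms(1) that by (metis (mono_tags, lifting) countable_UN countable_subset mem_Collect_eq)
qed

lemma rat_intervals_split:
  fixes Y V :: "real set"
  assumes "uncountable (Y \<inter> V)" "open V"
  obtains D E where "D \<in> rat_intervals" "E \<in> rat_intervals" "closure D \<subseteq> V" "closure E \<subseteq> V"
    "closure D \<inter> closure E = {}" "uncountable (Y \<inter> D)" "uncountable (Y \<inter> E)"
proof -
  obtain t where t: "uncountable (Y \<inter> V \<inter> {..<t})" "uncountable (Y \<inter> V \<inter> {t<..})"
    by (rule uncountable_split[OF assms(1)])
  have "uncountable (Y \<inter> (V \<inter> {..<t}))" "open (V \<inter> {..<t})"
    using t(1) assms(2) by (simp_all add: Int_assoc open_Int)
  then obtain D where D: "D \<in> rat_intervals" "closure D \<subseteq> V \<inter> {..<t}" "uncountable (Y \<inter> D)"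
    by (rule uncountable_rat_intervals)
  have "uncountable (Y \<inter> (V \<inter> {t<..}))" "open (V \<inter> {t<..})"
    using t(2) assms(2) by (simp_all add: Int_assoc open_Int)
  then obtain E where E: "E \<in> rat_intervals" "closure E \<subseteq> V \<inter> {t<..}" "uncountable (Y \<inter> E)"
    by (rule uncountable_rat_intervals)
  show ?thesis
  proof (rule that[OF D(1) E(1) _ _ _ D(3) E(3)])
    show "closure D \<subseteq> V" "closure E \<subseteq> V"
      using D(2) E(2) by auto
    have "{..<t} \<inter> {t<..} = {}"
      by auto
    then show "closure D \<inter> closure E = {}"
      using D(2) E(2) by blast
  qed
qed

text \<open>A finite promise about \<open>p\<close>: shrinking \<open>p\<close> during a fusion has
  to keep uncountably many points in each of these intervals. They are rational so that there are
  only countably many promises.\<close>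

definition splits :: "real set \<Rightarrow> real set set \<Rightarrow> bool" where
  "splits p \<O> \<longleftrightarrow> finite \<O> \<and> \<O> \<subseteq> rat_intervals \<and> (\<forall>U\<in>\<O>. uncountable (p \<inter> U))"

text \<open>One level of a Cantor scheme. Nesting the closures keeps limits of a branch inside it;
  their disjointness lets a branch dodge any given point.\<close>

definition forks :: "real set set \<Rightarrow> real set set \<Rightarrow> bool" where
  "forks \<O> \<O>' \<longleftrightarrow> (\<forall>U\<in>\<O>. \<exists>D\<in>\<O>'. \<exists>E\<in>\<O>'. closure D \<subseteq> U \<and> closure E \<subseteq> U \<and> closure D \<inter> closure E = {})"

lemma splits_fork:
  assumes "splits p \<O>"
  obtains \<O>' where "splits p \<O>'" "forks \<O> \<O>'"
proof -
  have "\<exists>D E. D \<in> rat_intervals \<and> E \<in> rat_intervals \<and> closure D \<subseteq> U \<and> closure E \<subseteq> U \<and>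
    closure D \<inter> closure E = {} \<and> uncountable (p \<inter> D) \<and> uncountable (p \<inter> E)" if "U \<in> \<O>" for U
    using rat_intervals_split[of p U] that assms unfolding splits_def
    by (metis open_rat_intervals subsetD)
  then obtain D E where DE: "\<And>U. U \<in> \<O> \<Longrightarrow> D U \<in> rat_intervals \<and> E U \<in> rat_intervals \<and>
    closure (D U) \<subseteq> U \<and> closure (E U) \<subseteq> U \<and>
    closure (D U) \<inter> closure (E U) = {} \<and> uncountable (p \<inter> D U) \<and> uncountable (p \<inter> E U)"
    by metis
  show ?thesis
  proof (rule that)
    show "splits p (D ` \<O> \<union> E ` \<O>)"
      using assms DE by (auto simp: splits_def)
    show "forks \<O> (D ` \<O> \<union> E ` \<O>)"
      unfolding forks_def using DE by (meson UnI1 UnI2 imageI)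
  qed
qed

lemma countable_subset_range:
  assumes "countable S"
  obtains x :: "nat \<Rightarrow> 'a" where "S \<subseteq> range x"
  using assms that[of "from_nat_into S"] that[of undefined] range_from_nat_into[of S]
  by (cases "S = {}") auto

text \<open>Cantor's diagonal argument: if \<open>x\<close> enumerated the part of the intersection
  inside \<open>U\<close>, a branch of intervals below \<open>U\<close> could avoid
  \<open>x n\<close> at step \<open>n\<close>, and compactness would give a point on the branch that
  is missing from the enumeration.\<close>

lemma fusion:
  assumes comp: "\<And>n. compact (p n)" and dec: "\<And>n. p (Suc n) \<subseteq> p n"
    and sp: "\<And>n. splits (p n) (\<O> n)" and fk: "\<And>n. forks (\<O> n) (\<O> (Suc n))"
    and U: "U \<in> \<O> 0"
  shows "uncountable ((\<Inter>n. p n) \<inter> U)"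
proof
  assume count: "countable ((\<Inter>n. p n) \<inter> U)"
  obtain x :: "nat \<Rightarrow> real" where x: "(\<Inter>n. p n) \<inter> U \<subseteq> range x"
    by (rule countable_subset_range[OF count])
  \<comment> \<open>Of two successors with disjoint closures at least one misses \<open>x n\<close>;
    the clause for \<open>n = 0\<close> pins the start of the branch to \<open>U\<close>.\<close>
  have "\<exists>W. \<forall>n. (W n \<in> \<O> n \<and> (n = 0 \<longrightarrow> W n = U)) \<and> (closure (W (Suc n)) \<subseteq> W n \<and> x n \<notin> closure (W (Suc n)))"
  proof (rule dependent_nat_choice)
    fix V n assume "V \<in> \<O> n \<and> (n = 0 \<longrightarrow> V = U)"
    then obtain D E where "D \<in> \<O> (Suc n)" "E \<in> \<O> (Suc n)" "closure D \<subseteq> V" "closure E \<subseteq> V"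
      "closure D \<inter> closure E = {}"
      using fk[of n] unfolding forks_def by blast
    then show "\<exists>V'. (V' \<in> \<O> (Suc n) \<and> (Suc n = 0 \<longrightarrow> V' = U)) \<and> closure V' \<subseteq> V \<and> x n \<notin> closure V'"
      by auto
  qed (use U in auto)
  then obtain W where W: "\<And>n. W n \<in> \<O> n" "W 0 = U" "\<And>n. closure (W (Suc n)) \<subseteq> W n"
    "\<And>n. x n \<notin> closure (W (Suc n))"
    by blast
  have pW: "p n \<inter> W n \<noteq> {}" for n
    using sp[of n] W(1)[of n] unfolding splits_def by (metis countable_empty)
  have "(\<Inter>n. p n \<inter> closure (W n)) \<noteq> {}"
  proof (rule compact_nest)
    show "compact (p n \<inter> closure (W n))" for n
      by (simp add: comp compact_Int_closed)
    show "p n \<inter> closure (W n) \<noteq> {}" for n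
      using pW[of n] closure_subset[of "W n"] by blast
    have "p (Suc n) \<inter> closure (W (Suc n)) \<subseteq> p n \<inter> closure (W n)" for n
      using dec W(3) closure_subset by blast
    then show "p n \<inter> closure (W n) \<subseteq> p m \<inter> closure (W m)" if "m \<le> n" for m n
      using that by (rule lift_Suc_antimono_le)
  qed
  then obtain y where y: "y \<in> p n" "y \<in> closure (W n)" for n
    by blast
  have "y \<in> U"
    using W(2,3) y(2)[of 1] by (metis One_nat_def subsetD)
  then obtain n where "y = x n"
    using x y(1) by blast
  then show False
    using W(4) y(2) by metis
qed

section \<open>Analytic sets and the perfect set theorem\<close>

text \<open>The type \<^typ>\<open>nat\<close> is not an instance of \<^class>\<open>complete_space\<close>, so sequences of
  reals take the place of the Baire space.\<close>

definition analytic :: "real set \<Rightarrow> bool" where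
  "analytic A \<longleftrightarrow> (\<exists>C :: ((nat \<Rightarrow> real) \<times> real) set. closed C \<and> A = snd ` C)"

lemma analytic_closed:
  assumes "closed A"
  shows "analytic A"
  unfolding analytic_def
  by (rule exI[of _ "UNIV \<times> A"]) (use assms in \<open>simp add: closed_Times\<close>)

lemma continuous_on_fst_coordinate: "continuous_on UNIV (\<lambda>z :: (nat \<Rightarrow> real) \<times> real. fst z k)"
  by (rule continuous_on_product_then_coordinatewise) (intro continuous_intros)

lemma closed_reindex:
  fixes g :: "nat \<Rightarrow> nat"
  assumes "closed (C :: ((nat \<Rightarrow> real) \<times> real) set)"
  shows "closed {z. (\<lambda>k. fst z (g k), snd z) \<in> C}"
proof -
  have "continuous_on UNIV (\<lambda>z :: (nat \<Rightarrow> real) \<times> real. (\<lambda>k. fst z (g k), snd z))"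
    by (intro continuous_on_Pair continuous_on_coordinatewise_then_product continuous_on_fst_coordinate
        continuous_intros)
  from closed_vimage[OF assms this] show ?thesis
    by (simp add: vimage_def)
qed

lemma analytic_UN:
  fixes A :: "nat \<Rightarrow> real set"
  assumes "\<And>n. analytic (A n)"
  shows "analytic (\<Union>n. A n)"
proof -
  obtain C :: "nat \<Rightarrow> ((nat \<Rightarrow> real) \<times> real) set" where C: "\<And>n. closed (C n)" "\<And>n. A n = snd ` C n"
    using assms unfolding analytic_def by metis
  \<comment> \<open>Coordinate 0 names the index of a set, and the shifted sequence is a witness for
    that set. Writing this as an intersection of unions of closed alternatives makes
    \<open>D\<close> closed; each alternative forces coordinate 0 to be a natural number.\<close>
  define D where "D = (\<Inter>n. {z. fst z 0 \<in> of_nat ` (- {n})} \<union>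
    {z. fst z 0 \<in> of_nat ` {n}} \<inter> {z. (\<lambda>k. fst z (Suc k), snd z) \<in> C n})"
  have cl: "closed {z :: (nat \<Rightarrow> real) \<times> real. fst z 0 \<in> of_nat ` N}" for N :: "nat set"
    using closed_vimage[OF closed_of_nat_image continuous_on_fst_coordinate] by (simp add: vimage_def)
  have "closed D"
    unfolding D_def by (intro closed_INT ballI closed_Un closed_Int closed_reindex cl C(1))
  moreover have "(\<Union>n. A n) = snd ` D"
  proof (intro set_eqI iffI)
    fix r assume "r \<in> (\<Union>n. A n)"
    then obtain n y where "(y, r) \<in> C n"
      using C(2) by fastforce
    then have "(case_nat (of_nat n) y, r) \<in> D"
      by (auto simp: D_def)
    then show "r \<in> snd ` D"
      by force
  next
    fix r assume "r \<in> snd ` D"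
    then obtain x where x: "(x, r) \<in> D"
      by auto
    obtain n where "x 0 = of_nat n"
      using x unfolding D_def by auto
    with x have "(\<lambda>k. x (Suc k), r) \<in> C n"
      unfolding D_def by (auto dest!: INT_D[of _ _ _ n])
    then show "r \<in> (\<Union>n. A n)"
      using C(2) by force
  qed
  ultimately show ?thesis
    unfolding analytic_def by blast
qed

lemma analytic_INT:
  fixes A :: "nat \<Rightarrow> real set"
  assumes "\<And>n. analytic (A n)"
  shows "analytic (\<Inter>n. A n)"
proof -
  obtain C :: "nat \<Rightarrow> ((nat \<Rightarrow> real) \<times> real) set" where C: "\<And>n. closed (C n)" "\<And>n. A n = snd ` C n"
    using assms unfolding analytic_def by metis
  \<comment> \<open>One sequence interleaves witnesses for all the sets: the one for
    \<open>A n\<close> is read off at the positions \<open>prod_encode (n, k)\<close>.\<close>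
  define D where "D = (\<Inter>n. {z. (\<lambda>k. fst z (prod_encode (n, k)), snd z) \<in> C n})"
  have "closed D"
    unfolding D_def by (intro closed_INT ballI closed_reindex C(1))
  moreover have "(\<Inter>n. A n) = snd ` D"
  proof (intro set_eqI iffI)
    fix r assume "r \<in> (\<Inter>n. A n)"
    then have "\<forall>n. \<exists>y. (y, r) \<in> C n"
      using C(2) by fastforce
    then obtain y where "\<And>n. (y n, r) \<in> C n"
      by metis
    then have "(\<lambda>m. case prod_decode m of (n, k) \<Rightarrow> y n k, r) \<in> D"
      by (auto simp: D_def)
    then show "r \<in> snd ` D"
      by force
  next
    fix r assume "r \<in> snd ` D"
    then obtain x where x: "(x, r) \<in> D"
      by auto
    have "r \<in> A n" for n
      using x C(2)[of n] unfolding D_def by force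
    then show "r \<in> (\<Inter>n. A n)"
      by blast
  qed
  ultimately show ?thesis
    unfolding analytic_def by blast
qed

lemma analytic_open:
  assumes "open V"
  shows "analytic V"
proof -
  let ?I = "insert {} (closure ` {U \<in> rat_intervals. closure U \<subseteq> V})"
  have "countable ?I"
    using countable_subset[OF _ countable_rat_intervals, of "{U \<in> rat_intervals. closure U \<subseteq> V}"] by auto
  then have range: "range (from_nat_into ?I) = ?I"
    by (simp add: range_from_nat_into)
  have "analytic (from_nat_into ?I n)" for n
    using from_nat_into[of ?I n] by (intro analytic_closed) (auto simp del: from_nat_into)
  then have "analytic (\<Union>(range (from_nat_into ?I)))"
    by (intro analytic_UN)
  moreover have "\<Union>?I = V"
  proof
    show "V \<subseteq> \<Union>?I"
    proof
      fix x assume "x \<in> V"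
      with assms obtain U where "U \<in> rat_intervals" "x \<in> U" "closure U \<subseteq> V"
        by (rule rat_intervals_nbhd)
      moreover have "x \<in> closure U"
        using \<open>x \<in> U\<close> closure_subset by blast
      ultimately show "x \<in> \<Union>?I"
        by blast
    qed
  qed auto
  ultimately show ?thesis
    using range by simp
qed

lemma analytic_borel:
  assumes "A \<in> sets borel"
  shows "analytic A"
proof -
  have "A \<in> sigma_sets UNIV {S. open S}"
    using assms sets_borel by blast
  \<comment> \<open>The complement of an analytic set need not be analytic, so the induction carries
    a set and its complement along together.\<close>
  then have "analytic A \<and> analytic (- A)"
  proof induction
    case (Basic a)
    then show ?case
      by (auto intro: analytic_open analytic_closed)
  next
    case Empty
    then show ?case
      by (auto intro: analytic_closed)
  next
    case (Compl a)
    then show ?case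
      by (simp add: Compl_eq_Diff_UNIV[symmetric])
  next
    case (Union a)
    then show ?case
      using analytic_UN[of a] analytic_INT[of "\<lambda>n. - a n"] by simp
  qed
  then show ?thesis ..
qed

text \<open>By separability countably many balls of radius \<open>e / 2\<close> cover
  \<open>E\<close>, and the trace of one of them must have an uncountable projection.\<close>

lemma analytic_shrink:
  fixes E :: "((nat \<Rightarrow> real) \<times> real) set"
  assumes "closed E" "uncountable (snd ` E)" "0 < e"
  obtains D where "closed D" "D \<subseteq> E" "uncountable (snd ` D)" "\<forall>x\<in>D. \<forall>y\<in>D. dist x y \<le> e"
proof -
  have "\<exists>Q :: ((nat \<Rightarrow> real) \<times> real) set. countable Q \<and> (\<forall>X. open X \<longrightarrow> X \<noteq> {} \<longrightarrow> (\<exists>d\<in>Q. d \<in> X))"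
    by (rule countable_dense_exists)
  then obtain Q :: "((nat \<Rightarrow> real) \<times> real) set"
    where Q: "countable Q" "\<forall>X. open X \<longrightarrow> X \<noteq> {} \<longrightarrow> (\<exists>d\<in>Q. d \<in> X)"
    by blast
  have "E \<subseteq> (\<Union>q\<in>Q. E \<inter> cball q (e / 2))"
  proof
    fix x assume "x \<in> E"
    obtain q where "q \<in> Q" "q \<in> ball x (e / 2)"
      using Q(2)[rule_format, of "ball x (e / 2)"] assms(3) by auto
    then show "x \<in> (\<Union>q\<in>Q. E \<inter> cball q (e / 2))"
      using \<open>x \<in> E\<close> by (auto simp: dist_commute intro!: bexI[of _ q])
  qed
  then have "snd ` E \<subseteq> (\<Union>q\<in>Q. snd ` (E \<inter> cball q (e / 2)))"
    by blast
  then obtain q where q: "uncountable (snd ` (E \<inter> cball q (e / 2)))"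
    using assms(2) Q(1) by (meson countable_UN countable_subset)
  show ?thesis
  proof (rule that)
    show "closed (E \<inter> cball q (e / 2))"
      using assms(1) by (simp add: closed_Int)
    show "\<forall>x\<in>E \<inter> cball q (e / 2). \<forall>y\<in>E \<inter> cball q (e / 2). dist x y \<le> e"
    proof (intro ballI)
      fix x y assume "x \<in> E \<inter> cball q (e / 2)" "y \<in> E \<inter> cball q (e / 2)"
      then show "dist x y \<le> e"
        using dist_triangle3[of x y q] by simp
    qed
  qed (use q in auto)
qed

lemma analytic_split:
  fixes E :: "((nat \<Rightarrow> real) \<times> real) set"
  assumes "closed E" "uncountable (snd ` E)" "0 < e"
  obtains D F where "closed D" "D \<subseteq> E" "uncountable (snd ` D)" "\<forall>x\<in>D. \<forall>y\<in>D. dist x y \<le> e"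
    "closed F" "F \<subseteq> E" "uncountable (snd ` F)" "\<forall>x\<in>F. \<forall>y\<in>F. dist x y \<le> e"
    "snd ` D \<inter> snd ` F = {}"
proof -
  have "uncountable (snd ` E \<inter> UNIV)" "open (UNIV :: real set)"
    using assms(2) by auto
  then obtain I J where "I \<in> rat_intervals" "J \<in> rat_intervals" "closure I \<subseteq> UNIV" "closure J \<subseteq> UNIV"
    and IJ: "closure I \<inter> closure J = {}" "uncountable (snd ` E \<inter> I)" "uncountable (snd ` E \<inter> J)"
    by (rule rat_intervals_split)
  have piece: "closed (E \<inter> snd -` closure I)" "uncountable (snd ` (E \<inter> snd -` closure I))"
    if "uncountable (snd ` E \<inter> I)" for I :: "real set"
  proof -
    show "closed (E \<inter> snd -` closure I)"
      using assms(1) by (intro closed_Int closed_vimage continuous_intros) auto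
    have "snd ` E \<inter> I \<subseteq> snd ` (E \<inter> snd -` closure I)"
      using closure_subset[of I] by auto
    then show "uncountable (snd ` (E \<inter> snd -` closure I))"
      using that countable_subset by blast
  qed
  obtain D where D: "closed D" "D \<subseteq> E \<inter> snd -` closure I" "uncountable (snd ` D)"
      "\<forall>x\<in>D. \<forall>y\<in>D. dist x y \<le> e"
    by (rule analytic_shrink[OF piece(1)[OF IJ(2)] piece(2)[OF IJ(2)] assms(3)])
  obtain F where F: "closed F" "F \<subseteq> E \<inter> snd -` closure J" "uncountable (snd ` F)"
      "\<forall>x\<in>F. \<forall>y\<in>F. dist x y \<le> e"
    by (rule analytic_shrink[OF piece(1)[OF IJ(3)] piece(2)[OF IJ(3)] assms(3)])
  have "snd ` D \<subseteq> closure I" "snd ` F \<subseteq> closure J" "D \<subseteq> E" "F \<subseteq> E"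
    using D(2) F(2) by auto
  with IJ(1) have "snd ` D \<inter> snd ` F = {}"
    by blast
  with D F \<open>D \<subseteq> E\<close> \<open>F \<subseteq> E\<close> that show ?thesis
    by simp
qed

text \<open>A Cantor scheme inside the closed set \<open>C\<close>: each level consists of finitely
  many closed pieces of shrinking diameter, each piece having two successors with disjoint
  projections. The points lying in pieces of every level form a compact set, whose projection is the
  desired \<open>K\<close>.\<close>

theorem analytic_perfect_set:
  assumes "analytic A" "uncountable A"
  obtains K where "compact K" "K \<subseteq> A" "uncountable K"
proof -
  obtain C :: "((nat \<Rightarrow> real) \<times> real) set" where C: "closed C" "A = snd ` C"
    using assms(1) unfolding analytic_def by blast
  \<comment> \<open>Level 0 is \<open>C\<close> itself, whose diameter is not controlled; the guard
    matters since \<open>1 / real 0\<close> equals 0.\<close>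
  define small :: "nat \<Rightarrow> ((nat \<Rightarrow> real) \<times> real) set \<Rightarrow> bool" where
    "small n E \<longleftrightarrow> closed E \<and> E \<subseteq> C \<and> uncountable (snd ` E) \<and>
      (0 < n \<longrightarrow> (\<forall>x\<in>E. \<forall>y\<in>E. dist x y \<le> 1 / real n))" for n E
  have "\<exists>\<C>. \<forall>n. (finite (\<C> n) \<and> \<C> n \<noteq> {} \<and> (\<forall>E\<in>\<C> n. small n E)) \<and>
    (\<forall>E\<in>\<C> n. \<exists>D\<in>\<C> (Suc n). \<exists>F\<in>\<C> (Suc n). D \<subseteq> E \<and> F \<subseteq> E \<and> snd ` D \<inter> snd ` F = {})"
  proof (rule dependent_nat_choice)
    show "\<exists>\<C>. finite \<C> \<and> \<C> \<noteq> {} \<and> (\<forall>E\<in>\<C>. small 0 E)"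
      by (rule exI[of _ "{C}"]) (use C assms(2) in \<open>auto simp: small_def\<close>)
  next
    fix \<C> n assume \<C>: "finite \<C> \<and> \<C> \<noteq> {} \<and> (\<forall>E\<in>\<C>. small n E)"
    have "\<exists>D F. small (Suc n) D \<and> small (Suc n) F \<and> D \<subseteq> E \<and> F \<subseteq> E \<and> snd ` D \<inter> snd ` F = {}"
      if "E \<in> \<C>" for E
    proof -
      have E: "closed E" "E \<subseteq> C" "uncountable (snd ` E)"
        using \<C> that unfolding small_def by auto
      have "0 < 1 / real (Suc n)"
        by simp
      then obtain D F where "closed D" "D \<subseteq> E" "uncountable (snd ` D)" "\<forall>x\<in>D. \<forall>y\<in>D. dist x y \<le> 1 / real (Suc n)"
        "closed F" "F \<subseteq> E" "uncountable (snd ` F)" "\<forall>x\<in>F. \<forall>y\<in>F. dist x y \<le> 1 / real (Suc n)"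
        "snd ` D \<inter> snd ` F = {}"
        by (rule analytic_split[OF E(1,3)])
      moreover from this E(2) have "small (Suc n) D" "small (Suc n) F"
        by (simp_all add: small_def)
      ultimately show ?thesis
        by blast
    qed
    then obtain D F where DF: "\<And>E. E \<in> \<C> \<Longrightarrow> small (Suc n) (D E) \<and> small (Suc n) (F E) \<and> D E \<subseteq> E \<and> F E \<subseteq> E \<and>
      snd ` (D E) \<inter> snd ` (F E) = {}"
      by metis
    show "\<exists>\<C>'. (finite \<C>' \<and> \<C>' \<noteq> {} \<and> (\<forall>E\<in>\<C>'. small (Suc n) E)) \<and>
      (\<forall>E\<in>\<C>. \<exists>D\<in>\<C>'. \<exists>F\<in>\<C>'. D \<subseteq> E \<and> F \<subseteq> E \<and> snd ` D \<inter> snd ` F = {})"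
    proof (intro exI conjI)
      show "finite (D ` \<C> \<union> F ` \<C>)" "D ` \<C> \<union> F ` \<C> \<noteq> {}"
        using \<C> by auto
      show "\<forall>E\<in>D ` \<C> \<union> F ` \<C>. small (Suc n) E"
        using DF by auto
      show "\<forall>E\<in>\<C>. \<exists>D'\<in>D ` \<C> \<union> F ` \<C>. \<exists>F'\<in>D ` \<C> \<union> F ` \<C>. D' \<subseteq> E \<and> F' \<subseteq> E \<and> snd ` D' \<inter> snd ` F' = {}"
        using DF by (meson UnI1 UnI2 imageI)
    qed
  qed
  then obtain \<C> where fin: "\<And>n. finite (\<C> n)" and ne: "\<And>n. \<C> n \<noteq> {}"
    and small: "\<And>n E. E \<in> \<C> n \<Longrightarrow> small n E"
    and split: "\<And>n E. E \<in> \<C> n \<Longrightarrow> \<exists>D\<in>\<C> (Suc n). \<exists>F\<in>\<C> (Suc n). D \<subseteq> E \<and> F \<subseteq> E \<and> snd ` D \<inter> snd ` F = {}"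
    by metis
  define Q where "Q = (\<Inter>n. \<Union>(\<C> n))"
  have "closed Q"
    unfolding Q_def using fin small by (intro closed_INT ballI closed_Union) (auto simp: small_def)
  have "compact Q"
    unfolding compact_eq_totally_bounded
  proof (intro conjI allI impI)
    show "complete Q"
      using \<open>closed Q\<close> by (simp add: complete_eq_closed)
    fix e :: real assume "0 < e"
    then obtain n where n: "0 < n" "1 / real n < e"
      using ex_inverse_of_nat_less[of e] by (auto simp: inverse_eq_divide)
    define c where "c E = (SOME x. x \<in> E)" for E :: "((nat \<Rightarrow> real) \<times> real) set"
    have "Q \<subseteq> (\<Union>x\<in>c ` \<C> n. ball x e)"
    proof
      fix x assume "x \<in> Q"
      then obtain E where E: "E \<in> \<C> n" "x \<in> E"
        unfolding Q_def by auto
      then have "c E \<in> E"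
        unfolding c_def by (metis someI_ex)
      then have "dist (c E) x < e"
        using small[OF E(1)] E(2) n unfolding small_def by fastforce
      then show "x \<in> (\<Union>x\<in>c ` \<C> n. ball x e)"
        using E(1) by auto
    qed
    then show "\<exists>k. finite k \<and> Q \<subseteq> (\<Union>x\<in>k. ball x e)"
      using fin by (intro exI[of _ "c ` \<C> n"]) simp
  qed
  have "uncountable (snd ` Q)"
  proof
    assume "countable (snd ` Q)"
    then obtain x :: "nat \<Rightarrow> real" where x: "snd ` Q \<subseteq> range x"
      by (rule countable_subset_range)
    \<comment> \<open>The diagonal argument again: the branch moves to a successor whose projection
      omits \<open>x n\<close>. The pieces shrink, so completeness yields a point on the whole
      branch.\<close>
    have "\<exists>E. \<forall>n. E n \<in> \<C> n \<and> (E (Suc n) \<subseteq> E n \<and> x n \<notin> snd ` E (Suc n))"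
    proof (rule dependent_nat_choice)
      show "\<exists>E. E \<in> \<C> 0"
        using ne by blast
      fix E n assume "E \<in> \<C> n"
      from split[OF this] show "\<exists>E'. E' \<in> \<C> (Suc n) \<and> E' \<subseteq> E \<and> x n \<notin> snd ` E'"
        by (metis disjoint_iff)
    qed
    then obtain E where E: "\<And>n. E n \<in> \<C> n" "\<And>n. E (Suc n) \<subseteq> E n" "\<And>n. x n \<notin> snd ` E (Suc n)"
      by blast
    have "\<exists>a. \<forall>n. a \<in> E n"
    proof (rule decreasing_closed_nest[of E])
      show "closed (E n)" "E n \<noteq> {}" for n
        using small[OF E(1)[of n]] unfolding small_def by auto
      show "E n \<subseteq> E m" if "m \<le> n" for m n
        using E(2) that by (rule lift_Suc_antimono_le)
      fix e :: real assume "0 < e"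
      then obtain n where n: "0 < n" "1 / real n < e"
        using ex_inverse_of_nat_less[of e] by (auto simp: inverse_eq_divide)
      then have "\<forall>x\<in>E n. \<forall>y\<in>E n. dist x y < e"
        using small[OF E(1)[of n]] unfolding small_def by fastforce
      then show "\<exists>n. \<forall>x\<in>E n. \<forall>y\<in>E n. dist x y < e" ..
    qed auto
    then obtain a where a: "\<And>n. a \<in> E n"
      by blast
    have "a \<in> Q"
      unfolding Q_def using a E(1) by blast
    then obtain n where "snd a = x n"
      using x by blast
    then show False
      using a[of "Suc n"] E(3)[of n] by (metis imageI)
  qed
  moreover have "compact (snd ` Q)"
    by (intro compact_continuous_image \<open>compact Q\<close> continuous_intros)
  moreover have "Q \<subseteq> C"
  proof
    fix z assume "z \<in> Q"
    then obtain E where "E \<in> \<C> 0" "z \<in> E"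
      unfolding Q_def by blast
    then show "z \<in> C"
      using small[of E 0] by (auto simp: small_def)
  qed
  ultimately show ?thesis
    using that C(2) by blast
qed

section \<open>Countable families of compact sets\<close>

text \<open>The reservoir of a condition: its union is the set of points still available, and its
  compact pieces serve to run fusions.\<close>

definition cantor_family :: "real set set \<Rightarrow> bool" where
  "cantor_family T \<longleftrightarrow> countable T \<and> (\<forall>p\<in>T. compact p) \<and> (\<exists>p\<in>T. uncountable p)"

text \<open>Besides shrinking the reservoir, \<open>S\<close> honours every finite promise about a
  piece of \<open>T\<close> by some smaller piece. This is what makes descending sequences of
  families fuse.\<close>

definition family_refines :: "real set set \<Rightarrow> real set set \<Rightarrow> bool" where
  "family_refines S T \<longleftrightarrow> \<Union>S \<subseteq> \<Union>T \<and> (\<forall>p\<in>T. \<forall>\<O>. splits p \<O> \<longrightarrow> (\<exists>q\<in>S. q \<subseteq> p \<and> splits q \<O>))"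

lemma family_refines_refl: "family_refines T T"
  by (auto simp: family_refines_def)

lemma family_refines_trans: "family_refines R S \<Longrightarrow> family_refines S T \<Longrightarrow> family_refines R T"
  unfolding family_refines_def by (meson subset_trans)

lemma family_refines_uncountable:
  assumes "family_refines S T" "cantor_family T"
  shows "\<exists>q\<in>S. uncountable q"
proof -
  obtain p where "p \<in> T" "uncountable (p \<inter> UNIV)"
    using assms(2) by (auto simp: cantor_family_def)
  obtain U where U: "U \<in> rat_intervals" "closure U \<subseteq> UNIV" "uncountable (p \<inter> U)"
    by (rule uncountable_rat_intervals[OF \<open>uncountable (p \<inter> UNIV)\<close> open_UNIV])
  then have "splits p {U}"
    by (simp add: splits_def)
  then obtain q where "q \<in> S" "splits q {U}"
    using assms(1) \<open>p \<in> T\<close> unfolding family_refines_def by blast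
  then show ?thesis
    unfolding splits_def by (metis countable_Int1 insertI1)
qed

lemma countable_splits:
  assumes "countable T"
  shows "countable {(p, \<O>). p \<in> T \<and> splits p \<O>}"
proof (rule countable_subset)
  show "{(p, \<O>). p \<in> T \<and> splits p \<O>} \<subseteq> T \<times> {\<O>. finite \<O> \<and> \<O> \<subseteq> rat_intervals}"
    by (auto simp: splits_def)
  show "countable (T \<times> {\<O>. finite \<O> \<and> \<O> \<subseteq> rat_intervals})"
    by (intro countable_SIGMA assms countable_Collect_finite_subset countable_rat_intervals)
qed

text \<open>There are only countably many pairs of a piece and a promise about it, so picking one
  good \<open>q\<close> for each pair yields a countable family again. The thinning steps below
  reduce to this local choice.\<close>

lemma family_refines_select:
  assumes T: "cantor_family T"
    and sel: "\<And>p \<O>. p \<in> T \<Longrightarrow> splits p \<O> \<Longrightarrow> \<exists>q. compact q \<and> q \<subseteq> p \<and> splits q \<O> \<and> \<Phi> q"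
  obtains S where "cantor_family S" "family_refines S T" "\<And>q. q \<in> S \<Longrightarrow> \<Phi> q"
proof -
  obtain q where q: "\<And>p \<O>. p \<in> T \<Longrightarrow> splits p \<O> \<Longrightarrow>
      compact (q p \<O>) \<and> q p \<O> \<subseteq> p \<and> splits (q p \<O>) \<O> \<and> \<Phi> (q p \<O>)"
    using sel by metis
  define S where "S = (\<lambda>(p, \<O>). q p \<O>) ` {(p, \<O>). p \<in> T \<and> splits p \<O>}"
  have ref: "family_refines S T"
    unfolding family_refines_def S_def using q by fastforce
  have "cantor_family S"
    unfolding cantor_family_def
  proof (intro conjI)
    show "countable S"
      unfolding S_def using T by (intro countable_image countable_splits) (auto simp: cantor_family_def)
    show "\<forall>p\<in>S. compact p"
      unfolding S_def using q by auto
    show "\<exists>p\<in>S. uncountable p"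
      using family_refines_uncountable[OF ref T] .
  qed
  moreover have "\<Phi> r" if "r \<in> S" for r
    using that q unfolding S_def by auto
  ultimately show ?thesis
    using that[of S] ref by simp
qed

lemma fusion_step:
  assumes "cantor_family T" "family_refines S T" "p \<in> T" "splits p \<O>"
  shows "\<exists>q \<O>'. q \<in> S \<and> q \<subseteq> p \<and> splits q \<O>' \<and> forks \<O> \<O>'"
proof -
  obtain \<O>' where \<O>': "splits p \<O>'" "forks \<O> \<O>'"
    using assms(4) by (rule splits_fork)
  then show ?thesis
    using assms(2,3) unfolding family_refines_def by blast
qed

lemma splits_fusion:
  assumes "\<And>n. compact (p n)" "\<And>n. p (Suc n) \<subseteq> p n"
    "\<And>n. splits (p n) (\<O> n)" "\<And>n. forks (\<O> n) (\<O> (Suc n))"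
  shows "splits (\<Inter>n. p n) (\<O> 0)"
  unfolding splits_def
proof (intro conjI ballI)
  show "finite (\<O> 0)" "\<O> 0 \<subseteq> rat_intervals"
    using assms(3)[of 0] by (simp_all add: splits_def)
  show "uncountable ((\<Inter>n. p n) \<inter> U)" if "U \<in> \<O> 0" for U
    using assms that by (rule fusion)
qed

lemma compact_INT_nat:
  fixes p :: "nat \<Rightarrow> real set"
  shows "(\<And>n. compact (p n)) \<Longrightarrow> compact (\<Inter>n. p n)"
  by (rule compact_Inter) auto

text \<open>From a piece of \<open>T k\<close>, walk through the later families, forking the promise
  at every step; the intersection of the walk keeps the original promise. The lower bound collects
  such intersections for all starting levels \<open>k\<close>.\<close>

lemma family_refines_limit:
  assumes T: "\<And>n. cantor_family (T n)" and ref: "\<And>n. family_refines (T (Suc n)) (T n)"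
  shows "\<exists>S. cantor_family S \<and> (\<forall>n. family_refines S (T n))"
proof -
  have anti: "\<Union>(T n) \<subseteq> \<Union>(T m)" if "m \<le> n" for m n
    by (rule lift_Suc_antimono_le[OF _ that]) (use ref in \<open>simp add: family_refines_def\<close>)
  have "\<exists>q. compact q \<and> q \<subseteq> p \<and> splits q \<O> \<and> (\<forall>n. q \<subseteq> \<Union>(T n))" if p: "p \<in> T k" "splits p \<O>" for k p \<O>
  proof -
    have "\<exists>s. \<forall>n. (fst (s n) \<in> T (k + n) \<and> splits (fst (s n)) (snd (s n)) \<and> (n = 0 \<longrightarrow> s n = (p, \<O>))) \<and>
      (fst (s (Suc n)) \<subseteq> fst (s n) \<and> forks (snd (s n)) (snd (s (Suc n))))"
    proof (rule dependent_nat_choice)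
      show "\<exists>s. fst s \<in> T (k + 0) \<and> splits (fst s) (snd s) \<and> (0 = 0 \<longrightarrow> s = (p, \<O>))"
        using p by auto
      fix s n assume "fst s \<in> T (k + n) \<and> splits (fst s) (snd s) \<and> (n = 0 \<longrightarrow> s = (p, \<O>))"
      then show "\<exists>s'. (fst s' \<in> T (k + Suc n) \<and> splits (fst s') (snd s') \<and> (Suc n = 0 \<longrightarrow> s' = (p, \<O>))) \<and>
          fst s' \<subseteq> fst s \<and> forks (snd s) (snd s')"
        using fusion_step[OF T ref, of "fst s" "k + n" "snd s"] by auto
    qed
    then obtain s where s: "\<And>n. fst (s n) \<in> T (k + n)" "\<And>n. splits (fst (s n)) (snd (s n))"
      "s 0 = (p, \<O>)" "\<And>n. fst (s (Suc n)) \<subseteq> fst (s n)" "\<And>n. forks (snd (s n)) (snd (s (Suc n)))"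
      by blast
    have comp: "compact (fst (s n))" for n
      using T s(1) unfolding cantor_family_def by blast
    let ?q = "\<Inter>n. fst (s n)"
    have "?q \<subseteq> p"
      using s(3) by (metis INF_lower UNIV_I fst_conv)
    moreover have "splits ?q \<O>"
      using splits_fusion[of "\<lambda>n. fst (s n)" "\<lambda>n. snd (s n)"] comp s by simp
    \<comment> \<open>Reservoirs decrease, so a set inside the one of level \<open>k + n\<close>
      lies in the one of level \<open>n\<close>.\<close>
    moreover have "?q \<subseteq> \<Union>(T n)" for n
    proof -
      have "?q \<subseteq> \<Union>(T (k + n))"
        using s(1)[of n] by blast
      also have "\<dots> \<subseteq> \<Union>(T n)"
        by (rule anti) simp
      finally show ?thesis .
    qed
    ultimately show ?thesis
      using compact_INT_nat[of "\<lambda>n. fst (s n)"] comp by blast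
  qed
  then have "\<exists>S. cantor_family S \<and> family_refines S (T k) \<and> (\<forall>q\<in>S. \<forall>n. q \<subseteq> \<Union>(T n))" for k
    using family_refines_select[OF T, of k "\<lambda>q. \<forall>n. q \<subseteq> \<Union>(T n)"] by metis
  then obtain S where S: "\<And>k. cantor_family (S k)" "\<And>k. family_refines (S k) (T k)" "\<And>k q n. q \<in> S k \<Longrightarrow> q \<subseteq> \<Union>(T n)"
    by metis
  show ?thesis
  proof (intro exI conjI allI)
    show "cantor_family (\<Union>k. S k)"
      using S(1) unfolding cantor_family_def by (auto intro!: countable_UN)
    show "family_refines (\<Union>k. S k) (T n)" for n
      using S(2)[of n] S(3) unfolding family_refines_def by blast
  qed
qed

text \<open>In each promised interval the Borel set \<open>p \<inter> U \<inter> B\<close> has an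
  uncountable compact subset by the perfect set theorem; the union of these finitely many sets keeps
  the promise.\<close>

lemma refine_borel:
  assumes "compact p" "splits p \<O>" "B \<in> sets borel" "\<And>U. U \<in> \<O> \<Longrightarrow> uncountable (p \<inter> U \<inter> B)"
  shows "\<exists>q. compact q \<and> q \<subseteq> p \<inter> B \<and> splits q \<O>"
proof -
  have "\<exists>K. compact K \<and> K \<subseteq> p \<inter> U \<inter> B \<and> uncountable K" if "U \<in> \<O>" for U
  proof -
    have "open U"
      using assms(2) that open_rat_intervals unfolding splits_def by blast
    then have "p \<inter> U \<inter> B \<in> sets borel"
      using sets.Int[OF sets.Int[OF borel_compact[OF assms(1)] borel_open] assms(3)] by blast
    from analytic_perfect_set[OF analytic_borel[OF this] assms(4)[OF that]] show ?thesis
      by metis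
  qed
  then obtain K where K: "\<And>U. U \<in> \<O> \<Longrightarrow> compact (K U) \<and> K U \<subseteq> p \<inter> U \<inter> B \<and> uncountable (K U)"
    by metis
  show ?thesis
  proof (intro exI conjI)
    show "compact (\<Union>U\<in>\<O>. K U)"
      using assms(2) K by (intro compact_UN) (auto simp: splits_def)
    show "(\<Union>U\<in>\<O>. K U) \<subseteq> p \<inter> B"
      using K by blast
    have "uncountable ((\<Union>U\<in>\<O>. K U) \<inter> U)" if "U \<in> \<O>" for U
    proof -
      have "K U \<subseteq> (\<Union>U\<in>\<O>. K U) \<inter> U"
        using K[OF that] that by blast
      then show ?thesis
        using K[OF that] countable_subset by blast
    qed
    then show "splits (\<Union>U\<in>\<O>. K U) \<O>"
      using assms(2) by (simp add: splits_def)
  qed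
qed

text \<open>Deleting countably many points keeps every promise, and \<open>refine_borel\<close>
  restores compactness. This is how points already used are taken out of the reservoir.\<close>

lemma family_refines_avoid:
  assumes T: "cantor_family T" and N: "countable N"
  obtains S where "cantor_family S" "family_refines S T" "\<Union>S \<inter> N = {}"
proof -
  have "\<exists>q. compact q \<and> q \<subseteq> p \<and> splits q \<O> \<and> q \<inter> N = {}" if "p \<in> T" "splits p \<O>" for p \<O>
  proof -
    have "compact p"
      using T that(1) by (simp add: cantor_family_def)
    moreover have "N \<in> sets borel"
      by (rule sets.countable) (simp_all add: N)
    then have "- N \<in> sets borel"
      by (rule borel_comp)
    moreover have "uncountable (p \<inter> U \<inter> - N)" if "U \<in> \<O>" for U
      using uncountable_minus_countable[OF _ N, of "p \<inter> U"] \<open>splits p \<O>\<close> that by (simp add: splits_def Diff_eq)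
    ultimately obtain q where "compact q" "q \<subseteq> p \<inter> - N" "splits q \<O>"
      using refine_borel[of p \<O> "- N"] \<open>splits p \<O>\<close> by metis
    then show ?thesis
      by (intro exI[of _ q]) auto
  qed
  from family_refines_select[OF T this] that show ?thesis
    by (metis Int_Un_distrib2 Sup_inf_eq_bot_iff)
qed

text \<open>The combinatorial core of the thinning. Were it false, each \<open>V\<close> containing
  \<open>F\<close> would have a countable trace on some member of \<open>\<S>\<close>; a point of
  each \<open>S\<close> outside the union \<open>N\<close> of these traces, together with
  \<open>F\<close>, would form a finite set captured by no \<open>V\<close>.\<close>

lemma capture_uncountable:
  fixes F :: "'a set"
  assumes "finite \<S>" "\<And>S. S \<in> \<S> \<Longrightarrow> uncountable S" "finite F" "countable \<U>"
    and cap: "\<And>G. finite G \<Longrightarrow> G \<subseteq> F \<union> \<Union>\<S> \<Longrightarrow> \<exists>V\<in>\<U>. G \<subseteq> V"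
  shows "\<exists>V\<in>\<U>. F \<subseteq> V \<and> (\<forall>S\<in>\<S>. uncountable (S \<inter> V))"
proof (rule ccontr)
  assume "\<not> ?thesis"
  then obtain s where s: "\<And>V. V \<in> \<U> \<Longrightarrow> F \<subseteq> V \<Longrightarrow> s V \<in> \<S> \<and> countable (s V \<inter> V)"
    by metis
  define N where "N = (\<Union>V\<in>{V \<in> \<U>. F \<subseteq> V}. s V \<inter> V)"
  have "countable N"
    unfolding N_def using assms(4) s
    by (intro countable_UN) (auto intro: countable_subset[OF _ assms(4)])
  have "\<exists>x. x \<in> S \<and> x \<notin> N" if "S \<in> \<S>" for S
    using assms(2)[OF that] \<open>countable N\<close> by (metis countable_subset subsetI)
  then obtain x where x: "\<And>S. S \<in> \<S> \<Longrightarrow> x S \<in> S \<and> x S \<notin> N"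
    by metis
  obtain V where V: "V \<in> \<U>" "F \<union> x ` \<S> \<subseteq> V"
    using cap[of "F \<union> x ` \<S>"] assms(1,3) x by auto
  then have "x (s V) \<in> s V \<inter> V"
    using s[of V] x[of "s V"] by auto
  then show False
    using V x[of "s V"] s[of V] unfolding N_def by blast
qed

text \<open>All pairs of a piece and a promise are fused simultaneously. At stage \<open>n\<close>
  every promise is forked, and the first \<open>n\<close> sets are shrunk into one member
  \<open>\<W> n (f n)\<close> that also contains those of the first \<open>n\<close> listed points
  that belong to \<open>A\<close>. So each resulting piece, and each point of \<open>A\<close>,
  eventually lies in the chosen members.\<close>

lemma family_refines_gamma:
  fixes \<W> :: "nat \<Rightarrow> nat \<Rightarrow> real set"
  assumes T: "cantor_family T" and A: "countable A"
    and borel: "\<And>n m. \<W> n m \<in> sets borel"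
    and cap: "\<And>n G. finite G \<Longrightarrow> G \<subseteq> A \<union> \<Union>T \<Longrightarrow> \<exists>m. G \<subseteq> \<W> n m"
  shows "\<exists>S f. cantor_family S \<and> family_refines S T \<and> (\<forall>x\<in>A \<union> \<Union>S. \<forall>\<^sub>F n in sequentially. x \<in> \<W> n (f n))"
proof -
  obtain a where a: "A \<subseteq> range (a :: nat \<Rightarrow> real)"
    using A by (rule countable_subset_range)
  define I where "I = {(p, \<O>). p \<in> T \<and> splits p \<O>}"
  have "countable I"
    unfolding I_def using T by (intro countable_splits) (simp add: cantor_family_def)
  obtain p where "p \<in> T"
    using T by (auto simp: cantor_family_def)
  then have "(p, {}) \<in> I"
    by (simp add: I_def splits_def)
  then have "I \<noteq> {}"
    by blast
  obtain e :: "nat \<Rightarrow> real set \<times> real set set" where e: "range e = I"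
    by (rule that[OF range_from_nat_into[OF \<open>I \<noteq> {}\<close> \<open>countable I\<close>]])
  define ok where "ok s \<longleftrightarrow> compact (fst s) \<and> fst s \<subseteq> \<Union>T \<and> splits (fst s) (snd s)"
    for s :: "real set \<times> real set set"
  have e_ok: "ok (e j)" for j
  proof -
    have "e j \<in> I"
      using e by blast
    then show ?thesis
      using T by (auto simp: I_def ok_def cantor_family_def)
  qed
  have "\<exists>s. \<forall>n. ((\<forall>j. ok (s n j)) \<and> (n = 0 \<longrightarrow> s n = e)) \<and>
    ((\<forall>j. fst (s (Suc n) j) \<subseteq> fst (s n j) \<and> forks (snd (s n j)) (snd (s (Suc n) j))) \<and>
     (\<exists>m. a ` {..<n} \<inter> A \<subseteq> \<W> n m \<and> (\<forall>j<n. fst (s (Suc n) j) \<subseteq> \<W> n m)))"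
  proof (rule dependent_nat_choice)
    show "\<exists>s. (\<forall>j. ok (s j)) \<and> (0 = 0 \<longrightarrow> s = e)"
      using e_ok by blast
  next
    fix s :: "nat \<Rightarrow> real set \<times> real set set" and n :: nat
    assume "(\<forall>j. ok (s j)) \<and> (n = 0 \<longrightarrow> s = e)"
    then have s: "ok (s j)" for j
      by blast
    have "\<exists>\<O>. splits (fst (s j)) \<O> \<and> forks (snd (s j)) \<O>" for j
      using s[of j] splits_fork[of "fst (s j)" "snd (s j)"] unfolding ok_def by metis
    then obtain \<O> where \<O>: "\<And>j. splits (fst (s j)) (\<O> j)" "\<And>j. forks (snd (s j)) (\<O> j)"
      by metis
    \<comment> \<open>The parts of the first \<open>n\<close> sets that the forked promises require
      to stay uncountable; there are finitely many.\<close>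
    define \<S> where "\<S> = (\<Union>j\<in>{..<n}. (\<lambda>U. fst (s j) \<inter> U) ` \<O> j)"
    have "\<exists>V\<in>range (\<W> n). a ` {..<n} \<inter> A \<subseteq> V \<and> (\<forall>S\<in>\<S>. uncountable (S \<inter> V))"
    proof (rule capture_uncountable)
      show "finite \<S>"
        unfolding \<S>_def using \<O>(1) by (simp add: splits_def)
      show "uncountable S" if "S \<in> \<S>" for S
        using that \<O>(1) unfolding \<S>_def by (auto simp: splits_def)
      have "\<Union>\<S> \<subseteq> \<Union>T"
        using s unfolding \<S>_def ok_def by blast
      then have "a ` {..<n} \<inter> A \<union> \<Union>\<S> \<subseteq> A \<union> \<Union>T"
        by (intro Un_mono) auto
      then show "\<exists>V\<in>range (\<W> n). G \<subseteq> V" if "finite G" "G \<subseteq> a ` {..<n} \<inter> A \<union> \<Union>\<S>" for G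
        using cap[OF that(1) subset_trans[OF that(2)], of n] by auto
    qed auto
    then obtain m where m: "a ` {..<n} \<inter> A \<subseteq> \<W> n m \<and> (\<forall>S\<in>\<S>. uncountable (S \<inter> \<W> n m))"
      by (elim bexE rangeE) simp
    \<comment> \<open>Sets with index at least \<open>n\<close> are not shrunk at this stage; only
      their promise has been forked.\<close>
    have "\<exists>q. compact q \<and> q \<subseteq> fst (s j) \<and> splits q (\<O> j) \<and> (j < n \<longrightarrow> q \<subseteq> \<W> n m)" for j
    proof (cases "j < n")
      case True
      have "\<exists>q. compact q \<and> q \<subseteq> fst (s j) \<inter> \<W> n m \<and> splits q (\<O> j)"
      proof (rule refine_borel)
        show "compact (fst (s j))"
          using s by (simp add: ok_def)
        show "uncountable (fst (s j) \<inter> U \<inter> \<W> n m)" if "U \<in> \<O> j" for U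
          by (rule bspec[OF conjunct2[OF m]]) (use True that in \<open>auto simp: \<S>_def\<close>)
      qed (simp_all add: borel \<O>)
      then show ?thesis
        by blast
    next
      case False
      then show ?thesis
        using s[of j] \<O>(1)[of j] unfolding ok_def by blast
    qed
    then obtain q where q: "\<And>j. compact (q j) \<and> q j \<subseteq> fst (s j) \<and> splits (q j) (\<O> j) \<and> (j < n \<longrightarrow> q j \<subseteq> \<W> n m)"
      by metis
    show "\<exists>s'. ((\<forall>j. ok (s' j)) \<and> (Suc n = 0 \<longrightarrow> s' = e)) \<and>
      ((\<forall>j. fst (s' j) \<subseteq> fst (s j) \<and> forks (snd (s j)) (snd (s' j))) \<and>
       (\<exists>m. a ` {..<n} \<inter> A \<subseteq> \<W> n m \<and> (\<forall>j<n. fst (s' j) \<subseteq> \<W> n m)))"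
    proof (intro exI[of _ "\<lambda>j. (q j, \<O> j)"] conjI allI exI[of _ m])
      show "ok (q j, \<O> j)" for j
        using q[of j] s[of j] by (auto simp: ok_def)
    qed (use q \<O>(2) m in auto)
  qed
  then obtain s where s: "\<And>n j. ok (s n j)" "s 0 = e" "\<And>n j. fst (s (Suc n) j) \<subseteq> fst (s n j)"
      "\<And>n j. forks (snd (s n j)) (snd (s (Suc n) j))"
    and "\<And>n. \<exists>m. a ` {..<n} \<inter> A \<subseteq> \<W> n m \<and> (\<forall>j<n. fst (s (Suc n) j) \<subseteq> \<W> n m)"
  proof (elim exE, goal_cases)
    case (1 s)
    show ?case
      by (rule 1(1)[of s]) (use 1(2) in \<open>simp_all add: all_conj_distrib\<close>)
  qed
  then obtain f where f: "\<And>n. a ` {..<n} \<inter> A \<subseteq> \<W> n (f n)" "\<And>n j. j < n \<Longrightarrow> fst (s (Suc n) j) \<subseteq> \<W> n (f n)"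
    by metis
  have sel: "\<exists>q. compact q \<and> q \<subseteq> p \<and> splits q \<O> \<and> (\<forall>\<^sub>F n in sequentially. q \<subseteq> \<W> n (f n))"
    if "p \<in> T" "splits p \<O>" for p \<O>
  proof -
    have "(p, \<O>) \<in> range e"
      using that e by (simp add: I_def)
    then obtain j where j: "e j = (p, \<O>)"
      by (metis imageE)
    let ?q = "\<Inter>n. fst (s n j)"
    have comp: "compact (fst (s n j))" for n
      using s(1) by (simp add: ok_def)
    have "splits ?q (snd (s 0 j))"
      by (rule splits_fusion[of "\<lambda>n. fst (s n j)" "\<lambda>n. snd (s n j)"]) (use comp s in \<open>simp_all add: ok_def\<close>)
    moreover have "?q \<subseteq> fst (s 0 j)"
      by blast
    moreover have "\<forall>\<^sub>F n in sequentially. ?q \<subseteq> \<W> n (f n)"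
      using eventually_gt_at_top[of j] by eventually_elim (use f(2) in blast)
    ultimately show ?thesis
      using compact_INT_nat[of "\<lambda>n. fst (s n j)", OF comp] s(2) j by auto
  qed
  obtain S where S: "cantor_family S" "family_refines S T" "\<And>q. q \<in> S \<Longrightarrow> \<forall>\<^sub>F n in sequentially. q \<subseteq> \<W> n (f n)"
    using family_refines_select[OF T sel] by blast
  show ?thesis
  proof (intro exI conjI ballI)
    show "cantor_family S" "family_refines S T"
      by (fact S)+
    fix x assume "x \<in> A \<union> \<Union>S"
    then consider k where "x = a k" "x \<in> A" | q where "x \<in> q" "q \<in> S"
      using a by blast
    then show "\<forall>\<^sub>F n in sequentially. x \<in> \<W> n (f n)"
    proof cases
      case 1
      show ?thesis
        using eventually_gt_at_top[of k] by eventually_elim (use f(1) 1 in blast)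
    next
      case 2
      then show ?thesis
        using S(3)[of q] by (auto elim: eventually_mono)
    qed
  qed
qed

section \<open>The transfinite construction\<close>

lemma continuum_hypothesis_wellorder:
  assumes "continuum_hypothesis"
  obtains R :: "(real \<times> real) set" where "wf R" "total R" "\<forall>x. countable {y. (y, x) \<in> R}"
proof -
  \<comment> \<open>The cardinal order of the reals: proper initial segments have smaller
    cardinality, so under CH they are countable.\<close>
  define r where "r = card_of (UNIV :: real set)"
  have wo: "Well_order r"
    unfolding r_def by (rule card_of_Well_order)
  have co: "Card_order r"
    unfolding r_def by (rule card_of_Card_order)
  have fld: "Field r = UNIV"
    unfolding r_def by (rule Field_card_of)
  show ?thesis
  proof (rule that[of "r - Id"])
    show "wf (r - Id)" "total (r - Id)"
      using wo fld unfolding well_order_on_def linear_order_on_def partial_order_on_def preorder_on_def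
      by auto
    show "\<forall>x. countable {y. (y, x) \<in> r - Id}"
    proof (rule allI, rule ccontr)
      fix x assume "uncountable {y. (y, x) \<in> r - Id}"
      then have "{y. (y, x) \<in> r - Id} \<approx> (UNIV :: real set)"
        using assms unfolding continuum_hypothesis_def by blast
      moreover have "{y. (y, x) \<in> r - Id} = underS r x"
        by (auto simp: underS_def)
      ultimately have "ordIso2 (card_of (underS r x)) r"
        unfolding r_def eqpoll_iff_card_of_ordIso by simp
      moreover have "ordLess2 (card_of (underS r x)) r"
        using card_of_underS[OF co, of x] fld by simp
      ultimately show False
        using not_ordLess_ordIso by blast
    qed
  qed
qed

text \<open>Running minima along an enumeration turn a countable chain into a descending sequence
  that passes below each element, so bounds for sequences suffice. Smaller means stronger
  here.\<close>

lemma countable_chain_bound: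
  assumes refl: "\<And>c. P c \<Longrightarrow> le c c" and trans: "\<And>c d e. le c d \<Longrightarrow> le d e \<Longrightarrow> le c e"
    and closed: "\<And>c :: nat \<Rightarrow> 'c. (\<And>n. P (c n)) \<Longrightarrow> (\<And>n. le (c (Suc n)) (c n)) \<Longrightarrow> \<exists>d. P d \<and> (\<forall>n. le d (c n))"
    and C: "countable C" "C \<noteq> {}" "\<And>c. c \<in> C \<Longrightarrow> P c"
    and chain: "\<And>c d. c \<in> C \<Longrightarrow> d \<in> C \<Longrightarrow> le c d \<or> le d c"
  shows "\<exists>d. P d \<and> (\<forall>c\<in>C. le d c)"
proof -
  define e where "e = from_nat_into C"
  have e: "range e = C"
    unfolding e_def using C by (simp add: range_from_nat_into)
  then have eC: "e n \<in> C" for n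
    by blast
  define g where "g = rec_nat (e 0) (\<lambda>n x. if le x (e (Suc n)) then x else e (Suc n))"
  have g: "g 0 = e 0" "g (Suc n) = (if le (g n) (e (Suc n)) then g n else e (Suc n))" for n
    by (simp_all add: g_def)
  have gC: "g n \<in> C" for n
    by (induction n) (simp_all add: g eC)
  have "le (g (Suc n)) (g n)" for n
    using chain[OF gC[of n] eC[of "Suc n"]] refl[OF C(3)[OF gC[of n]]] by (auto simp: g)
  then obtain d where d: "P d" "\<And>n. le d (g n)"
    using closed[of g] C(3)[OF gC] by blast
  have "le (g n) (e n)" for n
    by (cases n) (use refl[OF C(3)[OF eC]] in \<open>simp_all add: g\<close>)
  then have "le d (e n)" for n
    using d(2) trans by blast
  then show ?thesis
    using d(1) e by (intro exI[of _ d]) auto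
qed

text \<open>Stage \<open>i\<close> has only countably many predecessors, which form a chain by
  induction hypothesis; a lower bound of them is strengthened so as to meet the requirement
  \<open>D i\<close>.\<close>

lemma transfinite_chain:
  fixes R :: "('i \<times> 'i) set" and D :: "'i \<Rightarrow> 'c \<Rightarrow> bool"
  assumes R: "wf R" "total R" "\<And>i. countable {j. (j, i) \<in> R}"
    and refl: "\<And>c. P c \<Longrightarrow> le c c" and trans: "\<And>c d e. le c d \<Longrightarrow> le d e \<Longrightarrow> le c e"
    and closed: "\<And>c :: nat \<Rightarrow> 'c. (\<And>n. P (c n)) \<Longrightarrow> (\<And>n. le (c (Suc n)) (c n)) \<Longrightarrow> \<exists>d. P d \<and> (\<forall>n. le d (c n))"
    and start: "P p"
    and dense: "\<And>i c. P c \<Longrightarrow> \<exists>d. P d \<and> le d c \<and> D i d"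
  shows "\<exists>c. \<forall>i. P (c i) \<and> D i (c i) \<and> (\<forall>j. (j, i) \<in> R \<longrightarrow> le (c i) (c j))"
proof -
  define c where "c = wfrec R (\<lambda>c i. SOME d. P d \<and> D i d \<and> (\<forall>j. (j, i) \<in> R \<longrightarrow> le d (c j)))"
  have c_eq: "c i = (SOME d. P d \<and> D i d \<and> (\<forall>j. (j, i) \<in> R \<longrightarrow> le d (c j)))" for i
  proof -
    have "c i = (SOME d. P d \<and> D i d \<and> (\<forall>j. (j, i) \<in> R \<longrightarrow> le d (cut c R i j)))"
      unfolding c_def by (subst wfrec[OF R(1)]) simp
    also have "(\<lambda>d. P d \<and> D i d \<and> (\<forall>j. (j, i) \<in> R \<longrightarrow> le d (cut c R i j))) =
        (\<lambda>d. P d \<and> D i d \<and> (\<forall>j. (j, i) \<in> R \<longrightarrow> le d (c j)))"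
      by (auto simp: cut_apply)
    finally show ?thesis .
  qed
  have main: "P (c i) \<and> D i (c i) \<and> (\<forall>j. (j, i) \<in> R \<longrightarrow> le (c i) (c j))" for i
  proof (induction i rule: wf_induct_rule[OF R(1)])
    case (1 i)
    let ?C = "c ` {j. (j, i) \<in> R}"
    have "\<exists>d. P d \<and> (\<forall>c\<in>?C. le d c)"
    proof (cases "?C = {}")
      case True
      then show ?thesis
        using start by auto
    next
      case False
      show ?thesis
      proof (rule countable_chain_bound[OF refl trans closed _ False])
        show "countable ?C"
          using R(3) by simp
        show "P d" if "d \<in> ?C" for d
          using that 1 by blast
        show "le d e \<or> le e d" if de: "d \<in> ?C" "e \<in> ?C" for d e
        proof -
          obtain j k where jk: "d = c j" "(j, i) \<in> R" "e = c k" "(k, i) \<in> R"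
            using de by blast
          consider "j = k" | "(j, k) \<in> R" | "(k, j) \<in> R"
            using R(2) by (auto simp: total_on_def)
          then show ?thesis
            by cases (use jk 1 refl in blast)+
        qed
      qed
    qed
    then obtain d where "P d" "\<forall>c\<in>?C. le d c"
      by blast
    with dense[of d i] obtain d' where "P d'" "le d' d" "D i d'"
      by blast
    then have "P d' \<and> D i d' \<and> (\<forall>j. (j, i) \<in> R \<longrightarrow> le d' (c j))"
      using trans \<open>\<forall>c\<in>?C. le d c\<close> by blast
    then show ?case
      by (subst (1 2 3) c_eq) (rule someI)
  qed
  show ?thesis
    by (intro exI[of _ c] allI main)
qed

text \<open>There are no more Borel double sequences than reals: a Borel set is the projection of a
  closed set, a closed set is named by the basic open sets filling its complement, and countably
  many such names pack into one set of naturals.\<close>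

lemma borel_sequences_coded:
  "\<exists>\<tau> :: real \<Rightarrow> nat \<Rightarrow> nat \<Rightarrow> real set. \<forall>\<W>. (\<forall>n m. \<W> n m \<in> sets borel) \<longrightarrow> (\<exists>i. \<tau> i = \<W>)"
proof -
  obtain \<B> :: "((nat \<Rightarrow> real) \<times> real) set set"
    where \<B>: "countable \<B>" "\<And>C. C \<in> \<B> \<Longrightarrow> open C" "\<And>S. open S \<Longrightarrow> \<exists>U. U \<subseteq> \<B> \<and> S = \<Union>U"
    using univ_second_countable by blast
  obtain b :: "nat \<Rightarrow> ((nat \<Rightarrow> real) \<times> real) set" where b: "\<B> \<subseteq> range b"
    using \<B>(1) by (rule countable_subset_range)
  define code where "code z = snd ` (- (\<Union>n\<in>z. b n))" for z
  have code: "\<exists>z. code z = A" if A: "A \<in> sets borel" for A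
  proof -
    obtain C :: "((nat \<Rightarrow> real) \<times> real) set" where C: "closed C" "A = snd ` C"
      using analytic_borel[OF A] unfolding analytic_def by blast
    obtain U where U: "U \<subseteq> \<B>" "- C = \<Union>U"
      using \<B>(3)[of "- C"] C(1) by (auto simp: open_Compl)
    have "(\<Union>n\<in>{n. b n \<in> U}. b n) = \<Union>U"
      using U(1) b by blast
    then have "code {n. b n \<in> U} = A"
      unfolding code_def C(2) using U(2) by (metis double_complement)
    then show ?thesis ..
  qed
  obtain h :: "real \<Rightarrow> nat set" where "surj h"
    using nat_sets_eqpoll_reals unfolding eqpoll_def by (metis bij_betw_imp_surj bij_betw_inv_into)
  define \<tau> where "\<tau> i n m = code {k. prod_encode (n, prod_encode (m, k)) \<in> h i}" for i n m
  show ?thesis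
  proof (intro exI[of _ \<tau>] allI impI)
    fix \<W> :: "nat \<Rightarrow> nat \<Rightarrow> real set" assume "\<forall>n m. \<W> n m \<in> sets borel"
    then have "\<forall>n m. \<exists>z. code z = \<W> n m"
      using code by simp
    then obtain z where z: "\<And>n m. code (z n m) = \<W> n m"
      by (auto simp: choice_iff)
    obtain i where "{prod_encode (n, prod_encode (m, k)) |n m k. k \<in> z n m} = h i"
      by (rule exE[OF surjD[OF \<open>surj h\<close>]])
    note i = this[symmetric]
    have "\<tau> i n m = \<W> n m" for n m
      unfolding \<tau>_def i z[symmetric] by (rule arg_cong[of _ _ code]) auto
    then show "\<exists>i. \<tau> i = \<W>"
      by (intro exI[of _ i] ext)
  qed
qed

section \<open>Conditions and their extensions\<close>

type_synonym condition = "real set \<times> real set \<times> real set set"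

text \<open>Keeping the reservoir away from the chosen points prevents a point of one side from
  entering the other later. The bound \<open>{0..1}\<close> makes room for translating
  \<open>B\<close> away from \<open>A\<close>.\<close>

definition condition :: "condition \<Rightarrow> bool" where
  "condition = (\<lambda>(A, B, T). countable A \<and> countable B \<and> A \<inter> B = {} \<and> cantor_family T \<and>
     \<Union>T \<inter> (A \<union> B) = {} \<and> A \<union> B \<union> \<Union>T \<subseteq> {0..1})"

text \<open>New points come only from the old reservoir, so anything guaranteed for \<open>A\<close>
  together with the reservoir persists. The stronger condition is the first argument.\<close>

definition extends :: "condition \<Rightarrow> condition \<Rightarrow> bool" where
  "extends = (\<lambda>(A', B', T') (A, B, T). A \<subseteq> A' \<and> A' \<subseteq> A \<union> \<Union>T \<and> B \<subseteq> B' \<and> B' \<subseteq> B \<union> \<Union>T \<and> family_refines T' T)"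

lemma extends_iff:
  "extends (A', B', T') (A, B, T) \<longleftrightarrow>
     A \<subseteq> A' \<and> A' \<subseteq> A \<union> \<Union>T \<and> B \<subseteq> B' \<and> B' \<subseteq> B \<union> \<Union>T \<and> family_refines T' T"
  by (simp add: extends_def)

lemma extends_refl: "extends c c"
  by (cases c) (simp add: extends_iff family_refines_refl)

lemma extends_trans:
  assumes "extends c d" "extends d e"
  shows "extends c e"
proof -
  obtain A B T A' B' T' A'' B'' T'' where eqs: "e = (A, B, T)" "d = (A', B', T')" "c = (A'', B'', T'')"
    by (metis prod_cases3)
  have 1: "A' \<subseteq> A''" "A'' \<subseteq> A' \<union> \<Union>T'" "B' \<subseteq> B''" "B'' \<subseteq> B' \<union> \<Union>T'" "family_refines T'' T'"
    using assms(1) unfolding eqs extends_iff by simp_all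
  have 2: "A \<subseteq> A'" "A' \<subseteq> A \<union> \<Union>T" "B \<subseteq> B'" "B' \<subseteq> B \<union> \<Union>T" "family_refines T' T"
    using assms(2) unfolding eqs extends_iff by simp_all
  have "\<Union>T' \<subseteq> \<Union>T"
    using 2(5) by (simp add: family_refines_def)
  then show ?thesis
    unfolding eqs extends_iff
    using 1(1-4) 2(1-4) family_refines_trans[OF 1(5) 2(5)] by (intro conjI) blast+
qed

lemma condition_iff:
  "condition (A, B, T) \<longleftrightarrow> countable A \<and> countable B \<and> A \<inter> B = {} \<and> cantor_family T \<and>
     \<Union>T \<inter> (A \<union> B) = {} \<and> A \<union> B \<union> \<Union>T \<subseteq> {0..1}"
  by (simp add: condition_def)

lemma condition_swap: "condition (B, A, T) \<longleftrightarrow> condition (A, B, T)"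
  unfolding condition_iff by (simp add: Int_commute Un_commute conj_commute conj_left_commute)

lemma extends_swap: "extends (B', A', T') (B, A, T) \<longleftrightarrow> extends (A', B', T') (A, B, T)"
  unfolding extends_iff by (simp add: conj_commute conj_left_commute)

lemma condition_extend:
  assumes "condition (A, B, T)" "cantor_family S" "family_refines S T" "countable F" "countable G"
    "F \<union> G \<subseteq> \<Union>T" "F \<inter> G = {}" "\<Union>S \<inter> (F \<union> G) = {}"
  shows "condition (A \<union> F, B \<union> G, S)" "extends (A \<union> F, B \<union> G, S) (A, B, T)"
proof -
  define Y Z where "Y = \<Union>S" and "Z = \<Union>T"
  have c: "countable A" "countable B" "A \<inter> B = {}" "Z \<inter> (A \<union> B) = {}" "A \<union> B \<union> Z \<subseteq> {0..1}"
    using assms(1) by (simp_all add: condition_iff Z_def)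
  have "Y \<subseteq> Z"
    using assms(3) by (simp add: family_refines_def Y_def Z_def)
  show "extends (A \<union> F, B \<union> G, S) (A, B, T)"
    unfolding extends_iff Z_def[symmetric] using assms(3,6) by (auto simp: Z_def)
  have FG: "F \<union> G \<subseteq> Z" "F \<inter> G = {}" "Y \<inter> (F \<union> G) = {}"
    using assms(6-8) by (simp_all add: Y_def Z_def)
  have "(A \<union> F) \<inter> (B \<union> G) = {}" "Y \<inter> (A \<union> F \<union> (B \<union> G)) = {}" "A \<union> F \<union> (B \<union> G) \<union> Y \<subseteq> {0..1}"
    using c(3-5) FG \<open>Y \<subseteq> Z\<close> by blast+
  then show "condition (A \<union> F, B \<union> G, S)"
    unfolding condition_iff Y_def[symmetric] using assms(2,4,5) c(1,2) by simp
qed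

text \<open>The chosen parts are united and the families fused. Any two stages have a common later
  one, which keeps the sides disjoint.\<close>

lemma condition_limit:
  assumes c: "\<And>n. condition (c n)" "\<And>n. extends (c (Suc n)) (c n)"
  shows "\<exists>d. condition d \<and> (\<forall>n. extends d (c n))"
proof -
  have le: "extends (c m) (c n)" if "n \<le> m" for n m
    using that by (induction rule: dec_induct) (auto intro: extends_refl extends_trans c(2))
  define A where "A n = fst (c n)" for n
  define B where "B n = fst (snd (c n))" for n
  define T where "T n = snd (snd (c n))" for n
  have c_eq: "c n = (A n, B n, T n)" for n
    by (simp add: A_def B_def T_def)
  have AB: "countable (A n)" "countable (B n)" "A n \<inter> B n = {}" "cantor_family (T n)"
    "\<Union>(T n) \<inter> (A n \<union> B n) = {}" "A n \<union> B n \<union> \<Union>(T n) \<subseteq> {0..1}" for n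
    using c(1)[of n] unfolding c_eq condition_iff by auto
  have mono: "A n \<subseteq> A m" "A m \<subseteq> A n \<union> \<Union>(T n)" "B n \<subseteq> B m" "B m \<subseteq> B n \<union> \<Union>(T n)" if "n \<le> m" for n m
    using le[OF that] unfolding c_eq extends_iff by simp_all
  have "family_refines (T (Suc n)) (T n)" for n
    using c(2)[of n] unfolding c_eq extends_iff by simp
  then obtain S where S: "cantor_family S" "\<And>n. family_refines S (T n)"
    using family_refines_limit[of T] AB(4) by blast
  have bound: "A m \<subseteq> A n \<union> \<Union>(T n)" "B m \<subseteq> B n \<union> \<Union>(T n)" for n m
    using mono(2,4)[of n m] le_supI1[OF mono(1)[of m n]] le_supI1[OF mono(3)[of m n]] nat_le_linear[of n m]
    by metis+
  have "condition (\<Union>n. A n, \<Union>n. B n, S)"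
    unfolding condition_def
  proof (clarsimp, intro conjI)
    show "countable (\<Union>n. A n)" "countable (\<Union>n. B n)"
      using AB(1,2) by auto
    have "A n \<inter> B m = {}" for n m
      using AB(3)[of "max n m"] mono(1)[of n "max n m"] mono(3)[of m "max n m"] by auto
    then show "(\<Union>n. A n) \<inter> (\<Union>n. B n) = {}"
      by blast
    have ST: "\<Union>S \<subseteq> \<Union>(T n)" for n
      using S(2) unfolding family_refines_def by blast
    then show "\<Union>S \<inter> ((\<Union>n. A n) \<union> (\<Union>n. B n)) = {}"
      using AB(5) by blast
    show "(\<Union>n. A n) \<subseteq> {0..1}" "(\<Union>n. B n) \<subseteq> {0..1}" "\<Union>S \<subseteq> {0..1}"
      using AB(6) ST by blast+
  qed (rule S(1))
  moreover have "extends (\<Union>n. A n, \<Union>n. B n, S) (c n)" for n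
    unfolding c_eq extends_iff using S(2)[of n] bound[of _ n] by (intro conjI) blast+
  ultimately show ?thesis
    by blast
qed

text \<open>\<open>Z\<close> stands for the reservoir. Either a finite subset of \<open>A\<close>
  already witnesses that some \<open>\<W> n\<close> fails to be an omega-cover, or a selection is
  eventually right at all chosen and all available points. Both alternatives persist under
  extensions.\<close>

definition decided :: "(nat \<Rightarrow> nat \<Rightarrow> real set) \<Rightarrow> real set \<Rightarrow> real set \<Rightarrow> bool" where
  "decided \<W> A Z \<longleftrightarrow> (\<exists>n F. finite F \<and> F \<subseteq> A \<and> (\<forall>m. \<not> F \<subseteq> \<W> n m)) \<or>
     (\<exists>f. \<forall>x\<in>A \<union> Z. \<forall>\<^sub>F n in sequentially. x \<in> \<W> n (f n))"

lemma decided_mono: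
  assumes "decided \<W> A Z" "A \<subseteq> A'" "A' \<union> Z' \<subseteq> A \<union> Z"
  shows "decided \<W> A' Z'"
  using assms(1) unfolding decided_def
proof (elim disjE exE)
  fix n F assume "finite F \<and> F \<subseteq> A \<and> (\<forall>m. \<not> F \<subseteq> \<W> n m)"
  with assms(2) have "finite F \<and> F \<subseteq> A' \<and> (\<forall>m. \<not> F \<subseteq> \<W> n m)"
    by auto
  then show "(\<exists>n F. finite F \<and> F \<subseteq> A' \<and> (\<forall>m. \<not> F \<subseteq> \<W> n m)) \<or>
      (\<exists>f. \<forall>x\<in>A' \<union> Z'. \<forall>\<^sub>F n in sequentially. x \<in> \<W> n (f n))"
    by (intro disjI1 exI)
next
  fix f assume "\<forall>x\<in>A \<union> Z. \<forall>\<^sub>F n in sequentially. x \<in> \<W> n (f n)"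
  with assms(3) have "\<forall>x\<in>A' \<union> Z'. \<forall>\<^sub>F n in sequentially. x \<in> \<W> n (f n)"
    by (meson subsetD)
  then show "(\<exists>n F. finite F \<and> F \<subseteq> A' \<and> (\<forall>m. \<not> F \<subseteq> \<W> n m)) \<or>
      (\<exists>f. \<forall>x\<in>A' \<union> Z'. \<forall>\<^sub>F n in sequentially. x \<in> \<W> n (f n))"
    by (intro disjI2 exI)
qed

text \<open>If some finite set of chosen and available points is captured by no member of some
  family, it is moved into \<open>A\<close>; otherwise \<open>family_refines_gamma\<close>
  applies.\<close>

lemma extend_decided:
  assumes c: "condition (A, B, T)" and \<W>: "\<And>n m. \<W> n m \<in> sets borel"
  obtains A' T' where "condition (A', B, T')" "extends (A', B, T') (A, B, T)" "decided \<W> A' (\<Union>T')"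
proof (cases "\<exists>n F. finite F \<and> F \<subseteq> A \<union> \<Union>T \<and> (\<forall>m. \<not> F \<subseteq> \<W> n m)")
  case True
  then obtain n F where F: "finite F" "F \<subseteq> A \<union> \<Union>T" "\<And>m. \<not> F \<subseteq> \<W> n m"
    by blast
  have T: "cantor_family T"
    using c by (simp add: condition_def)
  obtain S where S: "cantor_family S" "family_refines S T" "\<Union>S \<inter> F = {}"
    by (rule family_refines_avoid[OF T countable_finite[OF F(1)]])
  have "F \<subseteq> \<Union>T \<union> A"
    using F(2) by blast
  then have "A \<union> (F - A) = A \<union> F" "F - A \<subseteq> \<Union>T"
    by blast+
  moreover have "\<Union>S \<inter> (F - A) = {}"
    using S(3) by blast
  ultimately have "condition (A \<union> F, B, S)" "extends (A \<union> F, B, S) (A, B, T)"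
    using condition_extend[OF c S(1,2), of "F - A" "{}"] F(1) by (simp_all add: countable_finite)
  moreover have "decided \<W> (A \<union> F) (\<Union>S)"
    unfolding decided_def using F(1,3) by blast
  ultimately show ?thesis
    by (rule that[of "A \<union> F" S])
next
  case False
  then have cap: "\<exists>m. F \<subseteq> \<W> n m" if "finite F" "F \<subseteq> A \<union> \<Union>T" for n F
    using that by blast
  have "cantor_family T" "countable A"
    using c by (simp_all add: condition_def)
  from family_refines_gamma[of T A \<W>, OF this \<W> cap]
  obtain S f where S: "cantor_family S" "family_refines S T"
    "\<forall>x\<in>A \<union> \<Union>S. \<forall>\<^sub>F n in sequentially. x \<in> \<W> n (f n)"
    by blast
  have "condition (A, B, S)" "extends (A, B, S) (A, B, T)"
    using condition_extend[OF c S(1,2), of "{}" "{}"] by simp_all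
  moreover have "decided \<W> A (\<Union>S)"
    unfolding decided_def using S(3) by blast
  ultimately show ?thesis
    by (rule that[of A S])
qed

text \<open>A point \<open>x\<close> of the reservoir is spent against \<open>C\<close>: it joins
  \<open>B\<close> if it lies in \<open>C\<close>, and \<open>A\<close> otherwise, so
  \<open>C\<close> can no longer contain \<open>A\<close> and miss \<open>B\<close>.\<close>

lemma extend_unseparated:
  assumes c: "condition (A, B, T)"
  obtains A' B' T' where "condition (A', B', T')" "extends (A', B', T') (A, B, T)"
    "(\<exists>x\<in>A'. x \<notin> C) \<or> (\<exists>x\<in>B'. x \<in> C)"
proof -
  have T: "cantor_family T"
    using c by (simp add: condition_def)
  then obtain p where "p \<in> T" "uncountable p"
    unfolding cantor_family_def by blast
  then obtain x where x: "x \<in> \<Union>T"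
    by (metis UnionI countable_empty ex_in_conv)
  obtain S where S: "cantor_family S" "family_refines S T" "\<Union>S \<inter> {x} = {}"
    by (rule family_refines_avoid[OF T, of "{x}"]) auto
  show ?thesis
  proof (cases "x \<in> C")
    case True
    have "condition (A, insert x B, S)" "extends (A, insert x B, S) (A, B, T)"
      using condition_extend[OF c S(1,2), of "{}" "{x}"] x S(3) by simp_all
    with True show ?thesis
      by (intro that[of A "insert x B" S]) auto
  next
    case False
    have "condition (insert x A, B, S)" "extends (insert x A, B, S) (A, B, T)"
      using condition_extend[OF c S(1,2), of "{x}" "{}"] x S(3) by simp_all
    with False show ?thesis
      by (intro that[of "insert x A" B S]) auto
  qed
qed

lemma decided_extends:
  assumes "extends (A', B', T') (A, B, T)"
  shows "decided \<W> A (\<Union>T) \<Longrightarrow> decided \<W> A' (\<Union>T')" "decided \<W> B (\<Union>T) \<Longrightarrow> decided \<W> B' (\<Union>T')"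
proof -
  have 1: "A \<subseteq> A'" "A' \<subseteq> A \<union> \<Union>T" "B \<subseteq> B'" "B' \<subseteq> B \<union> \<Union>T" "\<Union>T' \<subseteq> \<Union>T"
    using assms unfolding extends_iff family_refines_def by simp_all
  have "A' \<union> \<Union>T' \<subseteq> A \<union> \<Union>T" "B' \<union> \<Union>T' \<subseteq> B \<union> \<Union>T"
    using Un_mono[OF 1(2,5)] Un_mono[OF 1(4,5)] by (simp_all add: Un_assoc)
  then show "decided \<W> A (\<Union>T) \<Longrightarrow> decided \<W> A' (\<Union>T')" "decided \<W> B (\<Union>T) \<Longrightarrow> decided \<W> B' (\<Union>T')"
    using decided_mono[OF _ 1(1)] decided_mono[OF _ 1(3)] by blast+
qed

text \<open>\<open>\<W> 0 0\<close> doubles as the candidate for a separating set, so one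
  enumeration of Borel double sequences lists both the selection and the separation
  requirements.\<close>

definition settled :: "(nat \<Rightarrow> nat \<Rightarrow> real set) \<Rightarrow> condition \<Rightarrow> bool" where
  "settled \<W> = (\<lambda>(A, B, T). decided \<W> A (\<Union>T) \<and> decided \<W> B (\<Union>T) \<and>
     ((\<exists>x\<in>A. x \<notin> \<W> 0 0) \<or> (\<exists>x\<in>B. x \<in> \<W> 0 0)))"

lemma extend_settled:
  assumes c: "condition c" and \<W>: "\<And>n m. \<W> n m \<in> sets borel"
  shows "\<exists>d. condition d \<and> extends d c \<and> settled \<W> d"
proof -
  obtain A0 B0 T0 where c0: "c = (A0, B0, T0)"
    by (cases c)
  obtain A1 T1 where 1: "condition (A1, B0, T1)" "extends (A1, B0, T1) (A0, B0, T0)" "decided \<W> A1 (\<Union>T1)"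
    by (rule extend_decided[OF c[unfolded c0] \<W>])
  \<comment> \<open>The two sides exchange roles so that \<open>B\<close> is treated by the same
    lemma.\<close>
  have "condition (B0, A1, T1)"
    using 1(1) by (simp only: condition_swap[of B0])
  from this \<W> obtain B2 T2 where "condition (B2, A1, T2)" "extends (B2, A1, T2) (B0, A1, T1)"
    and 2: "decided \<W> B2 (\<Union>T2)"
    by (rule extend_decided)
  then have 2: "condition (A1, B2, T2)" "extends (A1, B2, T2) (A1, B0, T1)" "decided \<W> B2 (\<Union>T2)"
    by (simp_all only: condition_swap[of A1] extends_swap[of A1])
  obtain A3 B3 T3 where 3: "condition (A3, B3, T3)" "extends (A3, B3, T3) (A1, B2, T2)"
    "(\<exists>x\<in>A3. x \<notin> \<W> 0 0) \<or> (\<exists>x\<in>B3. x \<in> \<W> 0 0)"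
    by (rule extend_unseparated[OF 2(1)])
  have "settled \<W> (A3, B3, T3)"
    using 3(3) decided_extends[OF 3(2)] decided_extends[OF 2(2)] 1(3) 2(3) by (simp add: settled_def)
  moreover have "extends (A3, B3, T3) c"
    unfolding c0 by (rule extends_trans[OF 3(2) extends_trans[OF 2(2) 1(2)]])
  ultimately show ?thesis
    using 3(1) by blast
qed

text \<open>The selection principle freed from covers: the members are Borel in the whole line, may
  contain \<open>X\<close>, and are listed with possible repetitions. This form passes easily to
  translates and tails.\<close>

definition omega_selective :: "real set \<Rightarrow> bool" where
  "omega_selective X \<longleftrightarrow> (\<forall>\<W> :: nat \<Rightarrow> nat \<Rightarrow> real set. (\<forall>n m. \<W> n m \<in> sets borel) \<longrightarrow>
     (\<forall>n F. finite F \<and> F \<subseteq> X \<longrightarrow> (\<exists>m. F \<subseteq> \<W> n m)) \<longrightarrow>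
     (\<exists>f. \<forall>x\<in>X. \<forall>\<^sub>F n in sequentially. x \<in> \<W> n (f n)))"

text \<open>At the stage \<open>i\<close> deciding \<open>\<W>\<close>, finite failure is excluded
  by hypothesis, and the selection is right on the whole union, which lies in
  \<open>A i \<union> Z i\<close>.\<close>

lemma omega_selective_UN:
  assumes A: "\<And>i j. A j \<subseteq> A i \<union> Z i"
    and dec: "\<And>\<W>. (\<And>n m. \<W> n m \<in> sets borel) \<Longrightarrow> \<exists>i. decided \<W> (A i) (Z i)"
  shows "omega_selective (\<Union>i. A i)"
  unfolding omega_selective_def
proof (intro allI impI)
  fix \<W> :: "nat \<Rightarrow> nat \<Rightarrow> real set"
  assume borel: "\<forall>n m. \<W> n m \<in> sets borel"
    and cap: "\<forall>n F. finite F \<and> F \<subseteq> (\<Union>i. A i) \<longrightarrow> (\<exists>m. F \<subseteq> \<W> n m)"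
  obtain i where "decided \<W> (A i) (Z i)"
    using dec borel by blast
  moreover have "\<not> (\<exists>n F. finite F \<and> F \<subseteq> A i \<and> (\<forall>m. \<not> F \<subseteq> \<W> n m))"
    using cap by (meson UN_upper UNIV_I subset_trans)
  ultimately obtain f where "\<forall>x\<in>A i \<union> Z i. \<forall>\<^sub>F n in sequentially. x \<in> \<W> n (f n)"
    unfolding decided_def by blast
  then show "\<exists>f. \<forall>x\<in>(\<Union>i. A i). \<forall>\<^sub>F n in sequentially. x \<in> \<W> n (f n)"
    using A by (intro exI[of _ f]) blast
qed

lemma unseparated_omega_selective_pair:
  assumes "continuum_hypothesis"
  obtains A B :: "real set" where "omega_selective A" "omega_selective B" "A \<inter> B = {}"
    "A \<union> B \<subseteq> {0..1}" "\<forall>C\<in>sets borel. A \<subseteq> C \<longrightarrow> B \<inter> C \<noteq> {}"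
proof -
  obtain R :: "(real \<times> real) set" where R: "wf R" "total R" "\<forall>x. countable {y. (y, x) \<in> R}"
    using assms by (rule continuum_hypothesis_wellorder)
  obtain \<tau> :: "real \<Rightarrow> nat \<Rightarrow> nat \<Rightarrow> real set"
    where \<tau>: "\<And>\<W>. (\<And>n m. \<W> n m \<in> sets borel) \<Longrightarrow> \<exists>i. \<tau> i = \<W>"
    using borel_sequences_coded by metis
  have "cantor_family {{0..1 :: real}}"
    using uncountable_closed_interval[of 0 "1 :: real"] by (simp add: cantor_family_def)
  then have start: "condition ({}, {}, {{0..1}})"
    by (simp add: condition_def)
  \<comment> \<open>Some reals may code sequences that are not Borel; their requirement is
    void.\<close>
  have dense: "\<exists>d. condition d \<and> extends d c \<and> ((\<forall>n m. \<tau> i n m \<in> sets borel) \<longrightarrow> settled (\<tau> i) d)"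
    if "condition c" for i c
    using extend_settled[OF that, of "\<tau> i"] that extends_refl by blast
  have "\<exists>c. \<forall>i. condition (c i) \<and> ((\<forall>n m. \<tau> i n m \<in> sets borel) \<longrightarrow> settled (\<tau> i) (c i)) \<and>
      (\<forall>j. (j, i) \<in> R \<longrightarrow> extends (c i) (c j))"
    by (rule transfinite_chain[where P = condition and le = extends and
        D = "\<lambda>i d. (\<forall>n m. \<tau> i n m \<in> sets borel) \<longrightarrow> settled (\<tau> i) d",
        OF R(1,2) R(3)[rule_format] extends_refl extends_trans condition_limit start dense])
  then obtain c where c: "\<And>i. condition (c i)"
      "\<And>i. (\<forall>n m. \<tau> i n m \<in> sets borel) \<longrightarrow> settled (\<tau> i) (c i)"
      "\<And>i j. (j, i) \<in> R \<Longrightarrow> extends (c i) (c j)"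
    by metis
  define A where "A i = fst (c i)" for i
  define B where "B i = fst (snd (c i))" for i
  define T where "T i = snd (snd (c i))" for i
  have c_eq: "c i = (A i, B i, T i)" for i
    by (simp add: A_def B_def T_def)
  \<comment> \<open>As \<open>R\<close> is total, of two stages one extends the other. Hence the
    points and the reservoir of any single stage together contain all points ever chosen.\<close>
  have comparable: "i = j \<or>
      A j \<subseteq> A i \<and> B j \<subseteq> B i \<and> A i \<subseteq> A j \<union> \<Union>(T j) \<and> B i \<subseteq> B j \<union> \<Union>(T j) \<or>
      A i \<subseteq> A j \<and> B i \<subseteq> B j \<and> A j \<subseteq> A i \<union> \<Union>(T i) \<and> B j \<subseteq> B i \<union> \<Union>(T i)" for i j
  proof -
    consider "i = j" | "(j, i) \<in> R" | "(i, j) \<in> R"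
      using R(2) unfolding total_on_def by blast
    then show ?thesis
    proof cases
      case 2
      then show ?thesis
        using c(3)[OF 2] unfolding c_eq extends_iff by simp
    next
      case 3
      then show ?thesis
        using c(3)[OF 3] unfolding c_eq extends_iff by simp
    qed simp
  qed
  have AB: "A j \<subseteq> A i \<union> \<Union>(T i)" "B j \<subseteq> B i \<union> \<Union>(T i)" for i j
    using comparable[of i j] by (elim disjE; simp add: le_supI1)+
  have settled: "\<exists>i. settled \<W> (A i, B i, T i)" if \<W>: "\<And>n m. \<W> n m \<in> sets borel" for \<W>
  proof -
    obtain i where "\<tau> i = \<W>"
      using \<tau>[of \<W>, OF \<W>] by blast
    then show ?thesis
      using c(2)[of i] \<W> by (intro exI[of _ i]) (simp add: c_eq)
  qed
  have dA: "\<exists>i. decided \<W> (A i) (\<Union>(T i))" and dB: "\<exists>i. decided \<W> (B i) (\<Union>(T i))"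
    if "\<And>n m. \<W> n m \<in> sets borel" for \<W>
    using settled[of \<W>, OF that] unfolding settled_def by (auto simp del: Union_iff)
  show ?thesis
  proof (rule that[of "\<Union>i. A i" "\<Union>i. B i"])
    show "omega_selective (\<Union>i. A i)"
      using AB(1) dA by (rule omega_selective_UN)
    show "omega_selective (\<Union>i. B i)"
      using AB(2) dB by (rule omega_selective_UN)
    have disj: "A i \<inter> B i = {}" and sub: "A i \<union> B i \<subseteq> {0..1}" for i
      using c(1)[of i] unfolding c_eq condition_iff by simp_all
    have "A i \<inter> B j = {}" for i j
    proof -
      have "A i \<subseteq> A j \<or> B j \<subseteq> B i"
        using comparable[of i j] by blast
      then show ?thesis
        using disj[of i] disj[of j] by blast
    qed
    then show "(\<Union>i. A i) \<inter> (\<Union>i. B i) = {}"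
      by blast
    show "(\<Union>i. A i) \<union> (\<Union>i. B i) \<subseteq> {0..1}"
      using sub by blast
    \<comment> \<open>A Borel \<open>C\<close> is treated as a constant double sequence. Since the
      first union lies inside \<open>C\<close>, the settled stage must have put a point of
      \<open>C\<close> on the second side.\<close>
    show "\<forall>C\<in>sets borel. (\<Union>i. A i) \<subseteq> C \<longrightarrow> (\<Union>i. B i) \<inter> C \<noteq> {}"
    proof (intro ballI impI)
      fix C :: "real set" assume "C \<in> sets borel" "(\<Union>i. A i) \<subseteq> C"
      then obtain i where "settled (\<lambda>n m. C) (A i, B i, T i)"
        using settled[of "\<lambda>n m. C"] by blast
      then show "(\<Union>i. B i) \<inter> C \<noteq> {}"
        using \<open>(\<Union>i. A i) \<subseteq> C\<close> unfolding settled_def by blast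
    qed
  qed
qed

section \<open>Selecting from Borel covers\<close>

lemma omega_selectiveD:
  fixes \<W> :: "nat \<Rightarrow> nat \<Rightarrow> real set"
  assumes "omega_selective X" "\<And>n m. \<W> n m \<in> sets borel"
    and "\<And>n F. finite F \<Longrightarrow> F \<subseteq> X \<Longrightarrow> \<exists>m. F \<subseteq> \<W> n m"
  shows "\<exists>f. \<forall>x\<in>X. \<forall>\<^sub>F n in sequentially. x \<in> \<W> n (f n)"
proof (rule assms(1)[unfolded omega_selective_def, THEN spec[of _ \<W>], THEN mp, THEN mp])
  show "\<forall>n m. \<W> n m \<in> sets borel"
    using assms(2) by simp
  show "\<forall>n F. finite F \<and> F \<subseteq> X \<longrightarrow> (\<exists>m. F \<subseteq> \<W> n m)"
    using assms(3) by simp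
qed

lemma omega_selective_translate:
  assumes "omega_selective X"
  shows "omega_selective ((+) a ` X)"
  unfolding omega_selective_def
proof (intro allI impI)
  fix \<W> :: "nat \<Rightarrow> nat \<Rightarrow> real set"
  assume borel: "\<forall>n m. \<W> n m \<in> sets borel"
    and cap: "\<forall>n F. finite F \<and> F \<subseteq> (+) a ` X \<longrightarrow> (\<exists>m. F \<subseteq> \<W> n m)"
  define \<W>' where "\<W>' n m = (+) a -` \<W> n m" for n m
  have "\<W>' n m \<in> sets borel" for n m
    unfolding \<W>'_def using borel by (intro measurable_sets_borel[of _ borel]) auto
  moreover have "\<exists>m. F \<subseteq> \<W>' n m" if F: "finite F" "F \<subseteq> X" for n F
  proof -
    have "finite ((+) a ` F) \<and> (+) a ` F \<subseteq> (+) a ` X"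
      using F by auto
    with cap obtain m where "(+) a ` F \<subseteq> \<W> n m"
      by blast
    then show ?thesis
      unfolding \<W>'_def by blast
  qed
  ultimately obtain f where "\<forall>x\<in>X. \<forall>\<^sub>F n in sequentially. x \<in> \<W>' n (f n)"
    using omega_selectiveD[OF assms, of \<W>'] by blast
  then show "\<exists>f. \<forall>x\<in>(+) a ` X. \<forall>\<^sub>F n in sequentially. x \<in> \<W> n (f n)"
    by (intro exI[of _ f]) (simp add: \<W>'_def)
qed

lemma eventually_mem_iff_finite:
  "(\<forall>\<^sub>F n in sequentially. x \<in> V n) \<longleftrightarrow> finite {n. x \<notin> V n}"
  by (simp add: cofinite_eq_sequentially[symmetric] eventually_cofinite)

text \<open>The range is infinite because otherwise one value would recur infinitely often, hence
  contain every point, and so equal \<open>X\<close>.\<close>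

lemma gamma_cover_range:
  assumes sub: "\<And>n. V n \<subseteq> X" and ne: "\<And>n. V n \<noteq> X"
    and ev: "\<And>x. x \<in> X \<Longrightarrow> \<forall>\<^sub>F n in sequentially. x \<in> V n"
  shows "gamma_cover X (range V)"
  unfolding gamma_cover_def is_cover_def
proof (intro conjI ballI)
  show "\<Union>(range V) = X"
  proof
    show "X \<subseteq> \<Union>(range V)"
      using ev by (force simp: eventually_sequentially)
  qed (use sub in blast)
  show "X \<notin> range V"
    using ne by blast
  show "infinite (range V)"
  proof
    assume "finite (range V)"
    then obtain k where k: "infinite {n. V n = V k}"
      using pigeonhole_infinite[of UNIV V] by auto
    have "x \<in> V k" if "x \<in> X" for x
    proof (rule ccontr)
      assume "x \<notin> V k"
      then have "{n. V n = V k} \<subseteq> {n. x \<notin> V n}"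
        by auto
      then show False
        using k ev[OF that] finite_subset unfolding eventually_mem_iff_finite by blast
    qed
    then show False
      using sub[of k] ne[of k] by blast
  qed
  show "finite {U \<in> range V. x \<notin> U}" if "x \<in> X" for x
  proof (rule finite_subset)
    show "{U \<in> range V. x \<notin> U} \<subseteq> V ` {n. x \<notin> V n}"
      by auto
    show "finite (V ` {n. x \<notin> V n})"
      using ev[OF that] by (simp add: eventually_mem_iff_finite)
  qed
qed

lemma trace_sequence:
  fixes e :: "nat \<Rightarrow> real set"
  assumes "\<And>m. e m \<in> sets (restrict_space borel X)"
  shows "\<exists>w. \<forall>m. w m \<in> sets borel \<and> e m = X \<inter> w m"
proof -
  have "\<forall>m. \<exists>w. w \<in> sets borel \<and> e m = X \<inter> w"
    using assms unfolding sets_restrict_space by blast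
  then show ?thesis
    by (rule choice)
qed

lemma Borel_Gamma_range:
  assumes "\<And>n. V n \<in> sets borel" "\<And>n. X \<inter> V n \<noteq> X"
    and "\<And>x. x \<in> X \<Longrightarrow> \<forall>\<^sub>F n in sequentially. x \<in> V n"
  shows "range (\<lambda>n. X \<inter> V n) \<in> Borel_Gamma X"
proof -
  have "gamma_cover X (range (\<lambda>n. X \<inter> V n))"
    by (rule gamma_cover_range) (use assms(2,3) in auto)
  then show ?thesis
    using assms(1) unfolding borel_covers_def sets_restrict_space by auto
qed

lemma S1_I:
  assumes "infinite X"
    and "\<And>\<U> :: nat \<Rightarrow> real set set. (\<And>n. \<U> n \<in> \<UU> X) \<Longrightarrow> \<exists>V. (\<forall>n. V n \<in> \<U> n) \<and> range V \<in> \<VV> X"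
  shows "X \<in> S1 \<UU> \<VV>"
  unfolding S1_def
proof (intro CollectI conjI allI impI)
  show "infinite X"
    by (fact assms(1))
  fix \<U> :: "nat \<Rightarrow> real set set" assume "\<forall>n. \<U> n \<in> \<UU> X"
  then show "\<exists>V. (\<forall>n. V n \<in> \<U> n) \<and> range V \<in> \<VV> X"
    by (intro assms(2)) simp
qed

lemma omega_selective_S1:
  assumes "infinite X" "omega_selective X"
  shows "X \<in> S1 Borel_Omega Borel_Gamma"
proof (rule S1_I[OF assms(1)])
  fix \<U> :: "nat \<Rightarrow> real set set" assume "\<And>n. \<U> n \<in> Borel_Omega X"
  then have \<U>: "countable (\<U> n)" "\<And>U. U \<in> \<U> n \<Longrightarrow> U \<in> sets (restrict_space borel X)" "X \<notin> \<U> n"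
    "\<And>F. finite F \<Longrightarrow> F \<subseteq> X \<Longrightarrow> \<exists>U\<in>\<U> n. F \<subseteq> U" for n
    unfolding borel_covers_def omega_cover_def is_cover_def by auto
  have ne: "\<U> n \<noteq> {}" for n
    using \<U>(4)[of "{}" n] by auto
  define e where "e n = from_nat_into (\<U> n)" for n
  have e: "range (e n) = \<U> n" for n
    unfolding e_def using ne \<U>(1) by (simp add: range_from_nat_into)
  then have eU: "e n m \<in> \<U> n" for n m
    by blast
  have "\<exists>w. \<forall>m. w m \<in> sets borel \<and> e n m = X \<inter> w m" for n
    using trace_sequence[of "e n" X] \<U>(2)[OF eU] by blast
  then obtain w where w: "\<And>n m. w n m \<in> sets borel" "\<And>n m. e n m = X \<inter> w n m"
    by metis
  have "\<exists>m. F \<subseteq> w n m" if F: "finite F" "F \<subseteq> X" for n F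
  proof -
    obtain U where "U \<in> \<U> n" "F \<subseteq> U"
      using \<U>(4)[of F n, OF F] by blast
    then obtain m where "U = e n m"
      using e[of n] by blast
    then show ?thesis
      using \<open>F \<subseteq> U\<close> w(2) by auto
  qed
  from omega_selectiveD[of X w, OF assms(2) w(1) this]
  obtain f where f: "\<forall>x\<in>X. \<forall>\<^sub>F n in sequentially. x \<in> w n (f n)"
    by blast
  have "X \<inter> w n (f n) \<in> \<U> n" for n
    using eU w(2) by metis
  moreover from this have "X \<inter> w n (f n) \<noteq> X" for n
    using \<U>(3) by metis
  ultimately show "\<exists>V. (\<forall>n. V n \<in> \<U> n) \<and> range V \<in> Borel_Gamma X"
    using Borel_Gamma_range[of "\<lambda>n. w n (f n)" X] w(1) f
    by (intro exI[of _ "\<lambda>n. X \<inter> w n (f n)"]) blast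
qed

text \<open>Up to finitely many members, a tau-cover preorders the points linearly. So a finite
  \<open>F\<close> has a least point \<open>x\<close>: almost all members containing
  \<open>x\<close> contain \<open>F\<close>, and infinitely many contain \<open>x\<close>.\<close>

lemma tau_cover_captures:
  assumes \<U>: "tau_cover X \<U>" and F: "finite F" "F \<noteq> {}" "F \<subseteq> X"
  shows "infinite {U \<in> \<U>. F \<subseteq> U}"
proof -
  have "\<exists>x\<in>F. finite {U \<in> \<U>. x \<in> U \<and> \<not> F \<subseteq> U}"
    using F
  proof (induction rule: finite_ne_induct)
    case (singleton x)
    then show ?case
      by simp
  next
    case (insert y F)
    then obtain x where x: "x \<in> F" "finite {U \<in> \<U>. x \<in> U \<and> \<not> F \<subseteq> U}"
      by auto
    have "finite {U \<in> \<U>. \<not> (x \<in> U \<longrightarrow> y \<in> U)} \<or> finite {U \<in> \<U>. \<not> (y \<in> U \<longrightarrow> x \<in> U)}"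
      using \<U> x(1) insert.prems unfolding tau_cover_def by blast
    then show ?case
    proof
      assume "finite {U \<in> \<U>. \<not> (x \<in> U \<longrightarrow> y \<in> U)}"
      with x(2) have "finite ({U \<in> \<U>. x \<in> U \<and> \<not> F \<subseteq> U} \<union> {U \<in> \<U>. \<not> (x \<in> U \<longrightarrow> y \<in> U)})"
        by blast
      then have "finite {U \<in> \<U>. x \<in> U \<and> \<not> insert y F \<subseteq> U}"
        by (rule rev_finite_subset) auto
      then show ?thesis
        using x(1) by blast
    next
      assume "finite {U \<in> \<U>. \<not> (y \<in> U \<longrightarrow> x \<in> U)}"
      with x(2) have "finite ({U \<in> \<U>. x \<in> U \<and> \<not> F \<subseteq> U} \<union> {U \<in> \<U>. \<not> (y \<in> U \<longrightarrow> x \<in> U)})"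
        by blast
      then have "finite {U \<in> \<U>. y \<in> U \<and> \<not> insert y F \<subseteq> U}"
        by (rule rev_finite_subset) auto
      then show ?thesis
        by blast
    qed
  qed
  then obtain x where x: "x \<in> F" "finite {U \<in> \<U>. x \<in> U \<and> \<not> F \<subseteq> U}"
    by blast
  have "infinite {U \<in> \<U>. x \<in> U}"
    using \<U> x(1) F(3) unfolding tau_cover_def large_cover_def by blast
  moreover have "{U \<in> \<U>. x \<in> U} \<subseteq> {U \<in> \<U>. F \<subseteq> U} \<union> {U \<in> \<U>. x \<in> U \<and> \<not> F \<subseteq> U}"
    by blast
  ultimately show ?thesis
    using x(2) by (meson finite_Un finite_subset)
qed

text \<open>The \<open>n\<close>-th family offered for selection is the tail
  \<open>w (n + m)\<close> of an enumeration of the cover. Then the selected indices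
  \<open>n + f n\<close> are unbounded, so infinitely many distinct members are picked.\<close>

lemma tau_cover_select:
  assumes sel: "omega_selective A" and "A \<subseteq> X" "X \<noteq> {}" and \<U>: "\<U> \<in> Borel_Tau X"
  shows "\<exists>\<V>\<subseteq>\<U>. infinite \<V> \<and> (\<forall>x\<in>A. finite {V \<in> \<V>. x \<notin> V})"
proof -
  have tau: "tau_cover X \<U>" and "countable \<U>" and meas: "\<And>U. U \<in> \<U> \<Longrightarrow> U \<in> sets (restrict_space borel X)"
    using \<U> unfolding borel_covers_def by auto
  obtain a where "a \<in> X"
    using assms(3) by blast
  then have cap: "infinite {U \<in> \<U>. F \<subseteq> U}" if "finite F" "F \<subseteq> X" for F
    using tau_cover_captures[OF tau, of "insert a F"] that by (auto elim!: infinite_super[rotated])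
  have "infinite \<U>"
    using cap[of "{}"] by simp
  define e where "e = from_nat_into \<U>"
  have bij: "bij_betw e UNIV \<U>"
    unfolding e_def using \<open>countable \<U>\<close> \<open>infinite \<U>\<close> by (rule bij_betw_from_nat_into)
  then have range: "range e = \<U>" and inj: "inj e"
    by (auto simp: bij_betw_def)
  have "e m \<in> sets (restrict_space borel X)" for m
    using meas range by blast
  then obtain w where w: "\<And>m. w m \<in> sets borel" "\<And>m. e m = X \<inter> w m"
    using trace_sequence[of e X] by blast
  have "\<exists>m. F \<subseteq> w (n + m)" if F: "finite F" "F \<subseteq> A" for n F
  proof -
    have "{U \<in> \<U>. F \<subseteq> U} \<subseteq> e ` {m. F \<subseteq> e m}"
      using range by auto
    then have "infinite {m. F \<subseteq> e m}"
      using cap[of F] F \<open>A \<subseteq> X\<close> by (meson finite_imageI finite_subset subset_trans)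
    then obtain m where "n \<le> m" "F \<subseteq> e m"
      unfolding infinite_nat_iff_unbounded_le by blast
    then show ?thesis
      using w(2)[of m] by (intro exI[of _ "m - n"]) auto
  qed
  from omega_selectiveD[of A "\<lambda>n m. w (n + m)", OF sel w(1) this]
  obtain f where f: "\<forall>x\<in>A. \<forall>\<^sub>F n in sequentially. x \<in> w (n + f n)"
    by blast
  define I where "I = range (\<lambda>n. n + f n)"
  have "\<forall>n. \<exists>m\<ge>n. m \<in> I"
    unfolding I_def by (metis le_add1 rangeI)
  then have "infinite I"
    by (simp add: infinite_nat_iff_unbounded_le)
  show ?thesis
  proof (intro exI[of _ "e ` I"] conjI ballI)
    show "e ` I \<subseteq> \<U>"
      using range by blast
    show "infinite (e ` I)"
      using \<open>infinite I\<close> inj by (meson finite_imageD inj_on_subset subset_UNIV)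
    fix x assume "x \<in> A"
    then have "finite {n. x \<notin> w (n + f n)}"
      using f by (simp add: eventually_mem_iff_finite)
    moreover have "{V \<in> e ` I. x \<notin> V} \<subseteq> (\<lambda>n. e (n + f n)) ` {n. x \<notin> w (n + f n)}"
      unfolding I_def using \<open>x \<in> A\<close> \<open>A \<subseteq> X\<close> w(2) by auto
    ultimately show "finite {V \<in> e ` I. x \<notin> V}"
      by (meson finite_imageI finite_subset)
  qed
qed

text \<open>If some \<open>y\<close> lies in only finitely many members of \<open>\<V>\<close>, then
  \<open>y\<close> is below each point of \<open>A\<close> in the tau-preorder, since such a point
  lies in almost all of the infinite \<open>\<V>\<close>. So the members of \<open>\<U>\<close>
  containing \<open>y\<close> are as required; this family need not contain
  \<open>\<V>\<close>.\<close>

lemma tau_cover_enlarge: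
  assumes tau: "tau_cover X \<U>" and "A \<subseteq> X"
    and \<V>: "\<V> \<subseteq> \<U>" "infinite \<V>" "\<And>x. x \<in> A \<Longrightarrow> finite {V \<in> \<V>. x \<notin> V}"
  shows "\<exists>\<V>'\<subseteq>\<U>. (\<forall>x\<in>A. finite {V \<in> \<V>'. x \<notin> V}) \<and> (\<forall>x\<in>X. infinite {V \<in> \<V>'. x \<in> V})"
proof (cases "\<forall>x\<in>X. infinite {V \<in> \<V>. x \<in> V}")
  case True
  then show ?thesis
    using \<V> by blast
next
  case False
  then obtain y where y: "y \<in> X" "finite {V \<in> \<V>. y \<in> V}"
    by blast
  have large: "infinite {U \<in> \<U>. x \<in> U}" if "x \<in> X" for x
    using tau that unfolding tau_cover_def large_cover_def by blast
  have cmp: "finite {U \<in> \<U>. \<not> (x \<in> U \<longrightarrow> y \<in> U)} \<or> finite {U \<in> \<U>. \<not> (y \<in> U \<longrightarrow> x \<in> U)}" if "x \<in> X" for x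
    using tau that y(1) unfolding tau_cover_def by blast
  show ?thesis
  proof (intro exI[of _ "{U \<in> \<U>. y \<in> U}"] conjI ballI)
    fix x assume "x \<in> A"
    have "infinite {U \<in> \<U>. \<not> (x \<in> U \<longrightarrow> y \<in> U)}"
    proof
      assume "finite {U \<in> \<U>. \<not> (x \<in> U \<longrightarrow> y \<in> U)}"
      then have "finite ({V \<in> \<V>. x \<notin> V} \<union> {V \<in> \<V>. y \<in> V} \<union> {U \<in> \<U>. \<not> (x \<in> U \<longrightarrow> y \<in> U)})"
        using \<V>(3)[OF \<open>x \<in> A\<close>] y(2) by blast
      then have "finite \<V>"
        by (rule rev_finite_subset) (use \<V>(1) in blast)
      then show False
        using \<V>(2) by blast
    qed
    then have "finite {U \<in> \<U>. \<not> (y \<in> U \<longrightarrow> x \<in> U)}"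
      using cmp \<open>x \<in> A\<close> \<open>A \<subseteq> X\<close> by blast
    then show "finite {V \<in> {U \<in> \<U>. y \<in> U}. x \<notin> V}"
      by (rule rev_finite_subset) blast
  next
    fix x assume "x \<in> X"
    show "infinite {V \<in> {U \<in> \<U>. y \<in> U}. x \<in> V}"
    proof
      assume fin: "finite {V \<in> {U \<in> \<U>. y \<in> U}. x \<in> V}"
      from cmp[OF \<open>x \<in> X\<close>] show False
      proof
        assume "finite {U \<in> \<U>. \<not> (x \<in> U \<longrightarrow> y \<in> U)}"
        with fin have "finite ({V \<in> {U \<in> \<U>. y \<in> U}. x \<in> V} \<union> {U \<in> \<U>. \<not> (x \<in> U \<longrightarrow> y \<in> U)})"
          by blast
        then have "finite {U \<in> \<U>. x \<in> U}"
          by (rule rev_finite_subset) blast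
        then show False
          using large[OF \<open>x \<in> X\<close>] by blast
      next
        assume "finite {U \<in> \<U>. \<not> (y \<in> U \<longrightarrow> x \<in> U)}"
        with fin have "finite ({V \<in> {U \<in> \<U>. y \<in> U}. x \<in> V} \<union> {U \<in> \<U>. \<not> (y \<in> U \<longrightarrow> x \<in> U)})"
          by blast
        then have "finite {U \<in> \<U>. y \<in> U}"
          by (rule rev_finite_subset) blast
        then show False
          using large[OF y(1)] by blast
      qed
    qed
  qed blast
qed

lemma Borel_Tau_subfamily:
  assumes "\<U> \<in> Borel_Tau X" "\<V> \<subseteq> \<U>" "X \<noteq> {}" "\<And>x. x \<in> X \<Longrightarrow> infinite {V \<in> \<V>. x \<in> V}"
  shows "\<V> \<in> Borel_Tau X"
proof -
  have tau: "tau_cover X \<U>" and "countable \<U>" and meas: "\<And>U. U \<in> \<U> \<Longrightarrow> U \<in> sets (restrict_space borel X)"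
    using assms(1) unfolding borel_covers_def by auto
  have "\<Union>\<V> = X"
  proof
    show "\<Union>\<V> \<subseteq> X"
      using tau assms(2) unfolding tau_cover_def large_cover_def is_cover_def by blast
    show "X \<subseteq> \<Union>\<V>"
    proof
      fix x assume "x \<in> X"
      then have "{V \<in> \<V>. x \<in> V} \<noteq> {}"
        using assms(4) by (metis finite.emptyI)
      then show "x \<in> \<Union>\<V>"
        by blast
    qed
  qed
  then have "large_cover X \<V>"
    using tau assms(2,4) unfolding tau_cover_def large_cover_def is_cover_def by blast
  moreover have "finite {V \<in> \<V>. \<not> (x \<in> V \<longrightarrow> y \<in> V)} \<or> finite {V \<in> \<V>. \<not> (y \<in> V \<longrightarrow> x \<in> V)}"
    if "x \<in> X" "y \<in> X" for x y
  proof -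
    have "finite {V \<in> \<U>. \<not> (x \<in> V \<longrightarrow> y \<in> V)} \<or> finite {V \<in> \<U>. \<not> (y \<in> V \<longrightarrow> x \<in> V)}"
      using tau that unfolding tau_cover_def by blast
    moreover have "{V \<in> \<V>. \<not> (x \<in> V \<longrightarrow> y \<in> V)} \<subseteq> {V \<in> \<U>. \<not> (x \<in> V \<longrightarrow> y \<in> V)}"
      "{V \<in> \<V>. \<not> (y \<in> V \<longrightarrow> x \<in> V)} \<subseteq> {V \<in> \<U>. \<not> (y \<in> V \<longrightarrow> x \<in> V)}"
      using assms(2) by blast+
    ultimately show ?thesis
      by (elim disjE) (simp_all add: finite_subset)
  qed
  ultimately have "tau_cover X \<V>"
    unfolding tau_cover_def by blast
  then show ?thesis
    using \<open>countable \<U>\<close> meas assms(2) unfolding borel_covers_def by (auto intro: countable_subset)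
qed

text \<open>Selecting for \<open>A\<close> may destroy largeness at points of \<open>B\<close>. The
  step in between restores a tau-cover of the union, from which one selects for \<open>B\<close>,
  keeping what was gained on \<open>A\<close>.\<close>

lemma tau_cover_gamma_subfamily:
  assumes "omega_selective A" "omega_selective B" "A \<union> B \<noteq> {}" and \<U>: "\<U> \<in> Borel_Tau (A \<union> B)"
  shows "\<exists>\<V>\<subseteq>\<U>. infinite \<V> \<and> (\<forall>x\<in>A \<union> B. finite {V \<in> \<V>. x \<notin> V})"
proof -
  obtain \<V>0 where \<V>0: "\<V>0 \<subseteq> \<U>" "infinite \<V>0" "\<forall>x\<in>A. finite {V \<in> \<V>0. x \<notin> V}"
    using tau_cover_select[OF assms(1) Un_upper1 assms(3) \<U>] by blast
  have "tau_cover (A \<union> B) \<U>"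
    using \<U> by (simp add: borel_covers_def)
  from tau_cover_enlarge[OF this Un_upper1 \<V>0(1,2)] \<V>0(3)
  obtain \<V>1 where \<V>1: "\<V>1 \<subseteq> \<U>" "\<forall>x\<in>A. finite {V \<in> \<V>1. x \<notin> V}" "\<forall>x\<in>A \<union> B. infinite {V \<in> \<V>1. x \<in> V}"
    by blast
  have "\<V>1 \<in> Borel_Tau (A \<union> B)"
    using Borel_Tau_subfamily[OF \<U> \<V>1(1) assms(3)] \<V>1(3) by blast
  then obtain \<V>2 where \<V>2: "\<V>2 \<subseteq> \<V>1" "infinite \<V>2" "\<forall>x\<in>B. finite {V \<in> \<V>2. x \<notin> V}"
    using tau_cover_select[OF assms(2) Un_upper2 assms(3)] by blast
  have "finite {V \<in> \<V>2. x \<notin> V}" if "x \<in> A" for x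
    using \<V>1(2) that by (rule_tac rev_finite_subset[of "{V \<in> \<V>1. x \<notin> V}"]) (use \<V>2(1) in blast)+
  then show ?thesis
    using \<V>1(1) \<V>2 by (intro exI[of _ \<V>2]) blast
qed

text \<open>Selectivity is applied to tail intersections. A selection of tails stays valid when
  \<open>f\<close> is increased, so selections for two sets can be merged by taking maxima.\<close>

lemma omega_selective_tails:
  fixes w :: "nat \<Rightarrow> nat \<Rightarrow> real set"
  assumes "omega_selective A" "\<And>n m. w n m \<in> sets borel"
    and ev: "\<And>n x. x \<in> A \<Longrightarrow> \<forall>\<^sub>F m in sequentially. x \<in> w n m"
  shows "\<exists>f. \<forall>x\<in>A. \<forall>\<^sub>F n in sequentially. \<forall>m\<ge>f n. x \<in> w n m"
proof -
  define tail where "tail n m = (\<Inter>k\<in>{m..}. w n k)" for n m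
  have "tail n m \<in> sets borel" for n m
    unfolding tail_def using assms(2) by (intro sets.countable_INT') auto
  moreover have "\<exists>m. F \<subseteq> tail n m" if F: "finite F" "F \<subseteq> A" for n F
  proof -
    have "\<forall>\<^sub>F m in sequentially. \<forall>x\<in>F. x \<in> w n m"
      using F ev by (intro eventually_ball_finite) auto
    then obtain m where "\<And>k x. m \<le> k \<Longrightarrow> x \<in> F \<Longrightarrow> x \<in> w n k"
      unfolding eventually_sequentially by blast
    then have "F \<subseteq> tail n m"
      unfolding tail_def by blast
    then show ?thesis ..
  qed
  ultimately obtain f where "\<forall>x\<in>A. \<forall>\<^sub>F n in sequentially. x \<in> tail n (f n)"
    using omega_selectiveD[OF assms(1), of tail] by blast
  moreover have "x \<in> tail n m \<longleftrightarrow> (\<forall>k\<ge>m. x \<in> w n k)" for x n m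
    by (auto simp: tail_def)
  ultimately show ?thesis
    by (intro exI[of _ f]) simp
qed

lemma omega_selective_Un_S1_tau:
  assumes "infinite (A \<union> B)" "omega_selective A" "omega_selective B"
  shows "A \<union> B \<in> S1 Borel_Tau Borel_Gamma"
proof (rule S1_I[OF assms(1)])
  let ?X = "A \<union> B"
  have "?X \<noteq> {}"
    using assms(1) by (metis finite.emptyI)
  fix \<U> :: "nat \<Rightarrow> real set set" assume \<U>: "\<And>n. \<U> n \<in> Borel_Tau ?X"
  have "\<exists>\<V>\<subseteq>\<U> n. infinite \<V> \<and> (\<forall>x\<in>?X. finite {V \<in> \<V>. x \<notin> V})" for n
    by (rule tau_cover_gamma_subfamily[OF assms(2,3) \<open>?X \<noteq> {}\<close> \<U>])
  then obtain \<V> where \<V>: "\<And>n. \<V> n \<subseteq> \<U> n" "\<And>n. infinite (\<V> n)"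
    "\<And>n. \<forall>x\<in>?X. finite {V \<in> \<V> n. x \<notin> V}"
    by metis
  have U: "countable (\<U> n)" "\<And>U. U \<in> \<U> n \<Longrightarrow> U \<in> sets (restrict_space borel ?X)" "?X \<notin> \<U> n" for n
    using \<U>[of n] unfolding borel_covers_def tau_cover_def large_cover_def is_cover_def by auto
  define e where "e n = from_nat_into (\<V> n)" for n
  have "countable (\<V> n)" for n
    using \<V>(1) U(1) by (rule countable_subset)
  then have bij: "bij_betw (e n) UNIV (\<V> n)" for n
    unfolding e_def using \<V>(2) by (rule bij_betw_from_nat_into)
  then have eU: "e n m \<in> \<U> n" for n m
    using \<V>(1) unfolding bij_betw_def by blast
  have "\<exists>w. \<forall>m. w m \<in> sets borel \<and> e n m = ?X \<inter> w m" for n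
    using trace_sequence[of "e n" ?X] U(2)[OF eU] by blast
  then obtain w where w: "\<And>n m. w n m \<in> sets borel" "\<And>n m. e n m = ?X \<inter> w n m"
    by metis
  have ev: "\<forall>\<^sub>F m in sequentially. x \<in> w n m" if "x \<in> ?X" for n x
  proof -
    have "e n ` {m. x \<notin> w n m} \<subseteq> {V \<in> \<V> n. x \<notin> V}"
      using bij[of n] w(2) unfolding bij_betw_def by auto
    then have "finite (e n ` {m. x \<notin> w n m})"
      using \<V>(3)[of n] that finite_subset by blast
    then have "finite {m. x \<notin> w n m}"
      using bij[of n] unfolding bij_betw_def by (meson finite_imageD inj_on_subset subset_UNIV)
    then show ?thesis
      by (simp add: eventually_mem_iff_finite)
  qed
  obtain f where f: "\<forall>x\<in>A. \<forall>\<^sub>F n in sequentially. \<forall>m\<ge>f n. x \<in> w n m"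
    using omega_selective_tails[of A w, OF assms(2) w(1)] ev by blast
  obtain g where g: "\<forall>x\<in>B. \<forall>\<^sub>F n in sequentially. \<forall>m\<ge>g n. x \<in> w n m"
    using omega_selective_tails[of B w, OF assms(3) w(1)] ev by blast
  define V where "V n = w n (max (f n) (g n))" for n
  have "\<forall>\<^sub>F n in sequentially. x \<in> V n" if "x \<in> ?X" for x
    using that
  proof
    assume "x \<in> A"
    with f have "\<forall>\<^sub>F n in sequentially. \<forall>m\<ge>f n. x \<in> w n m"
      by blast
    then show ?thesis
      by eventually_elim (simp add: V_def)
  next
    assume "x \<in> B"
    with g have "\<forall>\<^sub>F n in sequentially. \<forall>m\<ge>g n. x \<in> w n m"
      by blast
    then show ?thesis
      by eventually_elim (simp add: V_def)
  qed
  moreover have VU: "?X \<inter> V n \<in> \<U> n" for n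
    unfolding V_def using eU w(2) by metis
  moreover have "?X \<inter> V n \<noteq> ?X" for n
    using VU[of n] U(3)[of n] by metis
  ultimately have "range (\<lambda>n. ?X \<inter> V n) \<in> Borel_Gamma ?X"
    using w(1) by (intro Borel_Gamma_range) (auto simp: V_def)
  then show "\<exists>V. (\<forall>n. V n \<in> \<U> n) \<and> range V \<in> Borel_Gamma ?X"
    using VU by (intro exI[of _ "\<lambda>n. ?X \<inter> V n"]) blast
qed

section \<open>Separation and the main theorem\<close>

lemma finite_separation:
  fixes F H :: "real set"
  assumes "finite F" "finite H" "F \<inter> H = {}"
  obtains \<O> where "finite \<O>" "\<O> \<subseteq> rat_intervals" "F \<subseteq> \<Union>\<O>" "closure (\<Union>\<O>) \<inter> H = {}"
proof -
  have "\<exists>U. U \<in> rat_intervals \<and> x \<in> U \<and> closure U \<subseteq> - H" if "x \<in> F" for x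
  proof -
    have "open (- H)" "x \<in> - H"
      using assms(2,3) that by (auto intro: finite_imp_closed)
    then show ?thesis
      by (rule rat_intervals_nbhd) blast
  qed
  then obtain U where U: "\<And>x. x \<in> F \<Longrightarrow> U x \<in> rat_intervals \<and> x \<in> U x \<and> closure (U x) \<subseteq> - H"
    by metis
  show ?thesis
  proof (rule that[of "U ` F"])
    show "finite (U ` F)" "U ` F \<subseteq> rat_intervals" "F \<subseteq> \<Union>(U ` F)"
      using assms(1) U by auto
    have "\<Union>(U ` F) \<subseteq> (\<Union>x\<in>F. closure (U x))"
      using closure_subset by blast
    then have "closure (\<Union>(U ` F)) \<subseteq> (\<Union>x\<in>F. closure (U x))"
      using assms(1) by (intro closure_minimal closed_UN) auto
    then show "closure (\<Union>(U ` F)) \<inter> H = {}"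
      using U by blast
  qed
qed

lemma gamma_cover_separation:
  assumes AB: "A \<union> B \<subseteq> {0..1}" "A \<inter> B = {}"
    and sub: "A \<union> (+) 2 ` B \<in> subcover_prop Open_Omega Open_Gamma"
  shows "\<exists>C\<in>sets borel. A \<subseteq> C \<and> B \<inter> C = {}"
proof (rule ccontr)
  assume nosep: "\<not> ?thesis"
  define Y where "Y = A \<union> (+) 2 ` B"
  \<comment> \<open>Taking the complement of the closure, rather than of \<open>G\<close>, makes the
    second part relatively open too.\<close>
  define W where "W G = A \<inter> G \<union> (+) 2 ` (B - closure G)" for G :: "real set"
  have A_le: "x \<le> 1" if "x \<in> A" for x
    using AB(1) that by auto
  have B_ge: "2 \<le> x" if "x \<in> (+) 2 ` B" for x
    using AB(1) that by auto
  have WA: "x \<in> W G \<longleftrightarrow> x \<in> G" if "x \<in> A" for x G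
    using that A_le[OF that] B_ge unfolding W_def by fastforce
  have WB: "2 + x \<in> W G \<longleftrightarrow> x \<notin> closure G" if "x \<in> B" for x G
    using that A_le[of "2 + x"] B_ge[of "2 + x"] unfolding W_def by auto
  define \<G> where "\<G> = Union ` {\<O>. finite \<O> \<and> \<O> \<subseteq> rat_intervals}"
  have open_\<G>: "open G" if "G \<in> \<G>" for G
    using that open_rat_intervals unfolding \<G>_def by blast
  have "countable \<G>"
    unfolding \<G>_def by (intro countable_image countable_Collect_finite_subset countable_rat_intervals)
  have open_W: "openin (top_of_set Y) (W G)" if "open G" for G
  proof -
    \<comment> \<open>\<open>A\<close> is bounded by 1 and the translate of \<open>B\<close> starts
      at 2; cutting at \<open>3/2\<close> lets one open set of reals induce both parts.\<close>
    define H where "H = G \<inter> {..<3/2} \<union> (\<lambda>x. x - 2) -` (- closure G) \<inter> {3/2<..}"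
    have "open ((\<lambda>x. x - 2) -` (- closure G))"
      by (intro open_vimage continuous_intros) auto
    then have "open H"
      unfolding H_def using that by (intro open_Un open_Int) auto
    moreover have "W G = Y \<inter> H"
    proof (intro set_eqI iffI)
      fix x assume "x \<in> W G"
      then consider "x \<in> A" "x \<in> G" | b where "b \<in> B" "b \<notin> closure G" "x = 2 + b"
        unfolding W_def by blast
      then show "x \<in> Y \<inter> H"
      proof cases
        case 1
        then show ?thesis
          using A_le[OF 1(1)] by (simp add: Y_def H_def)
      next
        case 2
        then show ?thesis
          using B_ge[of x] by (simp add: Y_def H_def)
      qed
    next
      fix x assume x: "x \<in> Y \<inter> H"
      then consider "x \<in> A" | b where "b \<in> B" "x = 2 + b"
        unfolding Y_def by blast
      then show "x \<in> W G"
      proof cases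
        case 1
        then show ?thesis
          using x A_le[OF 1] by (simp add: W_def H_def)
      next
        case 2
        then show ?thesis
          using x B_ge[of x] WB[OF 2(1)] by (simp add: H_def)
      qed
    qed
    ultimately show ?thesis
      unfolding openin_open by blast
  qed
  have omega: "\<exists>V\<in>W ` \<G>. F \<subseteq> V" if F: "finite F" "F \<subseteq> Y" for F
  proof -
    let ?F0 = "F \<inter> A" and ?F1 = "(\<lambda>x. x - 2) ` (F \<inter> (+) 2 ` B)"
    have "finite ?F0" "finite ?F1"
      using F(1) by auto
    moreover have "?F0 \<inter> ?F1 = {}"
      using AB(2) by auto
    ultimately obtain \<O> where \<O>: "finite \<O>" "\<O> \<subseteq> rat_intervals" "?F0 \<subseteq> \<Union>\<O>" "closure (\<Union>\<O>) \<inter> ?F1 = {}"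
      by (rule finite_separation)
    have "F \<subseteq> W (\<Union>\<O>)"
    proof
      fix x assume "x \<in> F"
      then consider "x \<in> A" | b where "b \<in> B" "x = 2 + b"
        using F(2) unfolding Y_def by blast
      then show "x \<in> W (\<Union>\<O>)"
      proof cases
        case 1
        then show ?thesis
          using WA[OF 1] \<open>x \<in> F\<close> \<O>(3) by blast
      next
        case 2
        have "b \<in> ?F1"
          using 2 \<open>x \<in> F\<close> by force
        then show ?thesis
          using WB[OF 2(1)] \<O>(4) 2(2) by blast
      qed
    qed
    then show ?thesis
      using \<O>(1,2) unfolding \<G>_def by blast
  qed
  \<comment> \<open>A member equal to \<open>Y\<close> would come from a single open
    \<open>G\<close> containing \<open>A\<close> and disjoint from \<open>B\<close>, which is
    already a Borel separation.\<close>
  have "Y \<notin> W ` \<G>"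
  proof
    assume "Y \<in> W ` \<G>"
    then obtain G where G: "G \<in> \<G>" "W G = Y"
      by blast
    have "A \<subseteq> G"
      using WA G(2) unfolding Y_def by blast
    moreover have "B \<inter> G = {}"
      using WB[of _ G] closure_subset[of G] G(2) unfolding Y_def by blast
    moreover have "G \<in> sets borel"
      using open_\<G>[OF G(1)] by simp
    ultimately show False
      using nosep by blast
  qed
  have "\<Union>(W ` \<G>) = Y"
  proof
    show "\<Union>(W ` \<G>) \<subseteq> Y"
      unfolding W_def Y_def by blast
    show "Y \<subseteq> \<Union>(W ` \<G>)"
    proof
      fix x assume "x \<in> Y"
      then show "x \<in> \<Union>(W ` \<G>)"
        using omega[of "{x}"] by auto
    qed
  qed
  with \<open>Y \<notin> W ` \<G>\<close> omega have "omega_cover Y (W ` \<G>)"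
    unfolding omega_cover_def is_cover_def by blast
  then have "W ` \<G> \<in> Open_Omega Y"
    unfolding open_covers_def using \<open>countable \<G>\<close> open_W open_\<G> by auto
  then obtain \<V> where \<V>: "\<V> \<subseteq> W ` \<G>" "\<V> \<in> Open_Gamma Y"
    using sub unfolding subcover_prop_def Y_def[symmetric] by blast
  then have "countable \<V>" "infinite \<V>" and fin: "\<And>x. x \<in> Y \<Longrightarrow> finite {V \<in> \<V>. x \<notin> V}"
    unfolding open_covers_def gamma_cover_def by auto
  define e where "e = from_nat_into \<V>"
  have bij: "bij_betw e UNIV \<V>"
    unfolding e_def using \<open>countable \<V>\<close> \<open>infinite \<V>\<close> by (rule bij_betw_from_nat_into)
  then have "\<forall>n. \<exists>G. G \<in> \<G> \<and> e n = W G"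
    using \<V>(1) unfolding bij_betw_def by blast
  then obtain G where G: "\<And>n. G n \<in> \<G>" "\<And>n. e n = W (G n)"
    by metis
  have ev: "\<forall>\<^sub>F n in sequentially. x \<in> W (G n)" if "x \<in> Y" for x
  proof -
    have "e ` {n. x \<notin> W (G n)} \<subseteq> {V \<in> \<V>. x \<notin> V}"
      using bij G(2) unfolding bij_betw_def by auto
    then have "finite (e ` {n. x \<notin> W (G n)})"
      using fin[OF that] finite_subset by blast
    then have "finite {n. x \<notin> W (G n)}"
      using bij unfolding bij_betw_def by (meson finite_imageD inj_on_subset subset_UNIV)
    then show ?thesis
      by (simp add: eventually_mem_iff_finite)
  qed
  \<comment> \<open>The lower limit of the sets \<open>G n\<close>. A point of \<open>A\<close> is
    eventually in \<open>G n\<close>, a point of \<open>B\<close> is eventually outside its closure,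
    so this Borel set separates the two.\<close>
  define C where "C = (\<Union>k. \<Inter>n\<in>{k..}. G n)"
  have "G n \<in> sets borel" for n
    using open_\<G>[OF G(1)] by simp
  then have "C \<in> sets borel"
    unfolding C_def by (intro sets.countable_UN sets.countable_INT' image_subsetI) auto
  moreover have "A \<subseteq> C"
  proof
    fix x assume "x \<in> A"
    then have "\<forall>\<^sub>F n in sequentially. x \<in> G n"
      using ev[of x] WA[of x] by (simp add: Y_def)
    then show "x \<in> C"
      unfolding C_def eventually_sequentially by auto
  qed
  moreover have "x \<notin> C" if "x \<in> B" for x
  proof
    assume "x \<in> C"
    then have "\<forall>\<^sub>F n in sequentially. x \<in> G n"
      unfolding C_def eventually_sequentially by auto
    moreover have "\<forall>\<^sub>F n in sequentially. x \<notin> closure (G n)"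
      using ev[of "2 + x"] WB[OF that] that by (simp add: Y_def)
    ultimately have "\<forall>\<^sub>F n in sequentially. False"
      by eventually_elim (use closure_subset in blast)
    then show False
      by simp
  qed
  ultimately show False
    using nosep by blast
qed

section \<open>Inclusions between the covering properties\<close>

lemma open_covers_subset_borel_covers: "open_covers K X \<subseteq> borel_covers K X"
proof
  fix \<U> assume \<U>: "\<U> \<in> open_covers K X"
  have "U \<in> sets (restrict_space borel X)" if "U \<in> \<U>" for U
  proof -
    obtain V where "open V" "U = X \<inter> V"
      using \<U> \<open>U \<in> \<U>\<close> unfolding open_covers_def openin_open by blast
    then show ?thesis
      unfolding sets_restrict_space by auto
  qed
  then show "\<U> \<in> borel_covers K X"
    using \<U> unfolding open_covers_def borel_covers_def by blast
qed

text \<open>Open covers are Borel, and what is selected from open covers is open again.\<close>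

lemma S1_Borel_subset_S1_Open:
  "S1 (borel_covers K) (borel_covers L) \<subseteq> S1 (open_covers K) (open_covers L)"
proof
  fix X assume X: "X \<in> S1 (borel_covers K) (borel_covers L)"
  show "X \<in> S1 (open_covers K) (open_covers L)"
  proof (rule S1_I)
    show "infinite X"
      using X by (simp add: S1_def)
    fix \<U> :: "nat \<Rightarrow> real set set" assume \<U>: "\<And>n. \<U> n \<in> open_covers K X"
    then have "\<forall>n. \<U> n \<in> borel_covers K X"
      using open_covers_subset_borel_covers by blast
    then obtain V where V: "\<forall>n. V n \<in> \<U> n" "range V \<in> borel_covers L X"
      using X unfolding S1_def by blast
    have "openin (top_of_set X) (V n)" for n
      using \<U>[of n] V(1) unfolding open_covers_def by blast
    then have "range V \<in> open_covers L X"
      using V(2) unfolding open_covers_def borel_covers_def by auto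
    then show "\<exists>V. (\<forall>n. V n \<in> \<U> n) \<and> range V \<in> open_covers L X"
      using V(1) by blast
  qed
qed

lemma S1_subset_subcover_prop: "S1 \<UU> \<VV> \<subseteq> subcover_prop \<UU> \<VV>"
proof
  fix X assume X: "X \<in> S1 \<UU> \<VV>"
  have "\<exists>\<V>. \<V> \<subseteq> \<U> \<and> \<V> \<in> \<VV> X" if \<U>: "\<U> \<in> \<UU> X" for \<U>
  proof -
    have "\<forall>\<U> :: nat \<Rightarrow> real set set. (\<forall>n. \<U> n \<in> \<UU> X) \<longrightarrow> (\<exists>V. (\<forall>n. V n \<in> \<U> n) \<and> range V \<in> \<VV> X)"
      using X by (simp add: S1_def)
    from this[THEN spec, of "\<lambda>n. \<U>"] obtain V where "\<forall>n::nat. V n \<in> \<U>" "range V \<in> \<VV> X"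
      using \<U> by auto
    then show ?thesis
      by (intro exI[of _ "range V"]) auto
  qed
  moreover have "infinite X"
    using X by (simp add: S1_def)
  ultimately show "X \<in> subcover_prop \<UU> \<VV>"
    unfolding subcover_prop_def by blast
qed

lemma subcover_prop_trans:
  assumes "X \<in> subcover_prop \<UU> \<VV>" "X \<in> subcover_prop \<VV> \<WW>"
  shows "X \<in> subcover_prop \<UU> \<WW>"
proof -
  have "\<exists>\<W>. \<W> \<subseteq> \<U> \<and> \<W> \<in> \<WW> X" if \<U>: "\<U> \<in> \<UU> X" for \<U>
  proof -
    obtain \<V> where \<V>: "\<V> \<subseteq> \<U>" "\<V> \<in> \<VV> X"
      using assms(1) \<U> unfolding subcover_prop_def by blast
    then obtain \<W> where "\<W> \<subseteq> \<V>" "\<W> \<in> \<WW> X"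
      using assms(2) unfolding subcover_prop_def by blast
    with \<V>(1) show ?thesis
      by blast
  qed
  then show ?thesis
    using assms(1) unfolding subcover_prop_def by blast
qed

theorem theorem5p7:
  assumes "continuum_hypothesis"
  shows "(\<exists>A B :: real set.
            A \<in> S1 Borel_Omega Borel_Gamma \<and>
            B \<in> S1 Borel_Omega Borel_Gamma \<and>
            A \<union> B \<notin> subcover_prop Open_Omega Open_Tau)
       \<and> S1 Open_Tau Open_Gamma \<noteq> S1 Open_Omega Open_Gamma
       \<and> S1 Borel_Tau Borel_Gamma \<noteq> S1 Borel_Omega Borel_Gamma"
proof -
  obtain A B :: "real set" where sel: "omega_selective A" "omega_selective B"
    and AB: "A \<inter> B = {}" "A \<union> B \<subseteq> {0..1}"
    and nosep: "\<forall>C\<in>sets borel. A \<subseteq> C \<longrightarrow> B \<inter> C \<noteq> {}"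
    using assms by (rule unseparated_omega_selective_pair)
  have finite_borel: "F \<in> sets borel" if "finite F" for F :: "real set"
    using that by (simp add: finite_imp_closed)
  \<comment> \<open>A finite \<open>A\<close> would be a Borel set separating itself from
    \<open>B\<close>; so would the complement of a finite \<open>B\<close>.\<close>
  have infA: "infinite A"
    using nosep finite_borel AB(1) by blast
  have infB: "infinite B"
  proof
    assume "finite B"
    then have "- B \<in> sets borel"
      by (intro borel_comp finite_borel)
    then show False
      using nosep AB(1) by blast
  qed
  \<comment> \<open>The two sets of the first claim are \<open>A\<close> and this translate; the gap
    between them makes both relatively clopen in their union.\<close>
  define B' where "B' = (+) 2 ` B"
  have selB': "omega_selective B'" and infB': "infinite B'"
    unfolding B'_def using omega_selective_translate[OF sel(2)] infB by (auto simp: finite_image_iff)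
  define Y where "Y = A \<union> B'"
  have "infinite Y"
    using infA by (simp add: Y_def)
  then have YB: "Y \<in> S1 Borel_Tau Borel_Gamma"
    unfolding Y_def using omega_selective_Un_S1_tau sel(1) selB' by blast
  then have YO: "Y \<in> S1 Open_Tau Open_Gamma"
    using S1_Borel_subset_S1_Open by blast
  have not\<Gamma>: "Y \<notin> subcover_prop Open_Omega Open_Gamma"
    using gamma_cover_separation[OF AB(2,1)] nosep unfolding Y_def B'_def by blast
  \<comment> \<open>By \<open>YO\<close>, open tau-covers of \<open>Y\<close> have gamma-subcovers,
    so tau-subcovers of all open omega-covers would contradict \<open>not\<Gamma>\<close>.\<close>
  have notT: "Y \<notin> subcover_prop Open_Omega Open_Tau"
    using subcover_prop_trans not\<Gamma> YO S1_subset_subcover_prop by blast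
  have "Y \<notin> S1 Open_Omega Open_Gamma"
    using not\<Gamma> S1_subset_subcover_prop by blast
  moreover from this have "Y \<notin> S1 Borel_Omega Borel_Gamma"
    using S1_Borel_subset_S1_Open by blast
  moreover have "A \<in> S1 Borel_Omega Borel_Gamma" "B' \<in> S1 Borel_Omega Borel_Gamma"
    using omega_selective_S1 infA sel(1) infB' selB' by blast+
  \<comment> \<open>The one set \<open>Y\<close> is the bad union and also lies in both classes
    starting from tau-covers but in neither starting from omega-covers.\<close>
  ultimately show ?thesis
    using YB YO notT unfolding Y_def by blast
qed

end
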